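(* Let $V:\mathbb{R}\to\mathbb{R}$ satisfy: (1) $V\in C^{2}(\mathbb{R})$ and $V(x+2\pi)=V(x)$ for all $x$; (2) $V$ achieves its global maximum at $x=\pi \bmod 2\pi$, with $V(\pi)=0$ and $V''(\pi)<0$; (3) $V(x)<0$ for all $x\notin \pi+2\pi\mathbb{Z}$. Let $\kappa\in\mathbb{R}$ satisfy $2\kappa>-V''(\pi)$. For $E>0$ let $p=p(t;E)$ be the running solution of $\ddot p+V'(p)=0$ with energy $E$, giving the synchronous solution $x=y=p(t;E)$ of $$\ddot x+V'(x)=\kappa(y-x),\qquad \ddot y+V'(y)=\kappa(x-y).$$ Then there exists a monotone decreasing sequence of disjoint segments $[E_{2n},E_{2n-1}]$, $n\ge 1$, clustering at $0$: $$E_1\ge E_2>E_3\ge E_4>\cdots\downarrow 0,$$ such that for each $n$ there is some $E\in[E_{2n},E_{2n-1}]$ for which the synchronous solution with energy $E$ is not strongly stable, i.e. the Floquet eigenvalues $\lambda_3$, $\lambda_4=\lambda_3^{-1}$ of $$\ddot w+(2\kappa+V''(p(t;E)))\,w=0$$ are real. Outside these segments, i.e. for $E\in(E_{2n+1},E_{2n})$, $n\ge1$, and for $E\in(E_1,\infty)$, the synchronous solution with energy $E$ is strongly stable.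
   Context: For $E>0$, $p(t;E)$ denotes the solution of $\ddot p+V'(p)=0$ with $\frac{\dot p^2}{2}+V(p)=E$, $p(0;E)=0$ and $\dot p>0$. It is increasing in $t$, and $p$ increases by $2\pi$ over the time $T(E)=\frac{1}{\sqrt2}\int_{-\pi}^{\pi}\frac{dx}{\sqrt{E-V(x)}}$, so $V''(p(t;E))$ is $T(E)$-periodic in $t$. Linearizing the coupled system about $x=y=p$ with perturbations $\xi,\eta$ and setting $u=\xi+\eta$, $w=\xi-\eta$ decouples it into $\ddot u+V''(p)u=0$ (whose Floquet eigenvalues are $\lambda_1=\lambda_2=1$) and $\ddot w+(2\kappa+V''(p))w=0$. The eigenvalues $\lambda_3,\lambda_4$ are those of the Floquet matrix of the $w$-equation, i.e. of the $2\times2$ matrix advancing $(w,\dot w)$ over one period $T(E)$; this matrix has determinant $1$. The synchronous solution (equivalently, its linearization) is called strongly stable if $\lambda_3,\lambda_4$ lie on the unit circle and differ from $\pm1$. *)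

theory Defs
  imports "HOL-Analysis.Analysis" "Jordan_Normal_Form.Spectral_Radius"
begin

definition C2_function :: "(real \<Rightarrow> real) \<Rightarrow> bool" where
  "C2_function V \<longleftrightarrow>
     (\<forall>x. V differentiable at x) \<and>
     (\<forall>x. deriv V differentiable at x) \<and>
     continuous_on UNIV (deriv (deriv V))"

definition solves_coupled ::
    "(real \<Rightarrow> real) \<Rightarrow> real \<Rightarrow> (real \<Rightarrow> real) \<Rightarrow> (real \<Rightarrow> real) \<Rightarrow> bool" where
  "solves_coupled V \<kappa> x y \<longleftrightarrow>
     (\<exists>x' y'. \<forall>t.
        (x has_real_derivative x' t) (at t) \<and>
        (y has_real_derivative y' t) (at t) \<and>
        (x' has_real_derivative (\<kappa> * (y t - x t) - deriv V (x t))) (at t) \<and>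
        (y' has_real_derivative (\<kappa> * (x t - y t) - deriv V (y t))) (at t))"

definition is_running_solution :: "(real \<Rightarrow> real) \<Rightarrow> real \<Rightarrow> (real \<Rightarrow> real) \<Rightarrow> bool" where
  "is_running_solution V E p \<longleftrightarrow>
     p 0 = 0 \<and>
     (\<exists>v. \<forall>t.
        (p has_real_derivative v t) (at t) \<and>
        (v has_real_derivative - deriv V (p t)) (at t) \<and>
        (v t)\<^sup>2 / 2 + V (p t) = E \<and>
        v t > 0)"

(* For the potentials considered here and E > 0, such a solution exists on the whole
   line and is unique, as it solves p' = sqrt (2 * (E - V p)), p 0 = 0, where
   E - V is bounded and bounded away from 0. *)
definition running_solution :: "(real \<Rightarrow> real) \<Rightarrow> real \<Rightarrow> real \<Rightarrow> real" where
  "running_solution V E = (THE p. is_running_solution V E p)"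

definition running_period :: "(real \<Rightarrow> real) \<Rightarrow> real \<Rightarrow> real" where
  "running_period V E = 1 / sqrt 2 * integral {-pi..pi} (\<lambda>x. 1 / sqrt (E - V x))"

(* w'' + q w = 0, with w' = v *)
definition hill_solution :: "(real \<Rightarrow> real) \<Rightarrow> (real \<Rightarrow> real) \<Rightarrow> (real \<Rightarrow> real) \<Rightarrow> bool" where
  "hill_solution q w v \<longleftrightarrow>
     (\<forall>t. (w has_real_derivative v t) (at t) \<and>
          (v has_real_derivative - q t * w t) (at t))"

(* For continuous q every initial vector is attained by exactly one solution, so exactly
   one matrix has this property. *)
definition floquet_matrix :: "(real \<Rightarrow> real) \<Rightarrow> real \<Rightarrow> real mat" where
  "floquet_matrix q T =
     (THE M. M \<in> carrier_mat 2 2 \<and>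
        (\<forall>w v. hill_solution q w v \<longrightarrow>
           vec_of_list [w T, v T] = M *\<^sub>v vec_of_list [w 0, v 0]))"

(* The set consisting of lambda_3 and lambda_4, the complex eigenvalues of the Floquet
   matrix of w'' + (2 kappa + V''(p(t;E))) w = 0 over the time T(E). *)
definition transverse_eigenvalues :: "(real \<Rightarrow> real) \<Rightarrow> real \<Rightarrow> real \<Rightarrow> complex set" where
  "transverse_eigenvalues V \<kappa> E =
     spectrum (map_mat complex_of_real
       (floquet_matrix (\<lambda>t. 2 * \<kappa> + deriv (deriv V) (running_solution V E t))
          (running_period V E)))"

definition strongly_stable :: "(real \<Rightarrow> real) \<Rightarrow> real \<Rightarrow> real \<Rightarrow> bool" where
  "strongly_stable V \<kappa> E \<longleftrightarrow>
     (\<forall>l \<in> transverse_eigenvalues V \<kappa> E. cmod l = 1 \<and> l \<noteq> 1 \<and> l \<noteq> -1)"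

end

theory Submission
  imports Defs
begin

text \<open>The transverse equation \<open>w'' + (2\<kappa> + V''(p)) w = 0\<close> has a Floquet matrix of determinant 1, so its
eigenvalues are the roots of \<open>l\<^sup>2 - \<tau> l + 1\<close>, where \<open>\<tau>\<close> is the trace. They lie on the unit circle and differ
from \<open>\<plusminus>1\<close> when \<open>\<bar>\<tau>\<bar> < 2\<close>, and they are a real pair \<open>r, 1/r\<close> when \<open>\<bar>\<tau>\<bar> \<ge> 2\<close>. The theorem is thus a
statement about \<open>\<tau>\<close> as a function of the energy \<open>E > 0\<close>, and three properties of it suffice:
continuity, \<open>\<bar>\<tau>\<bar> < 2\<close> for all large \<open>E\<close>, and the presence, arbitrarily close to \<open>E = 0\<close>, both of
energies with \<open>\<bar>\<tau>\<bar> \<ge> 2\<close> and of energies with \<open>\<bar>\<tau>\<bar> < 2\<close>. The segments are then obtained by picking, in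
turn, an unstable energy and a small stable interval below it (\<open>alternating_energy_sequence\<close>).

Along a running solution the position \<open>x = p(t)\<close> is a legitimate new independent variable. With the
slowness \<open>a = dt/dx = 1 / sqrt (2 (E - V x))\<close> and \<open>q x = 2\<kappa> + V'' x\<close> the equation becomes \<open>w' = a v\<close>,
\<open>v' = - a q w\<close> on the fixed interval from 0 to \<open>2\<pi>\<close>, and the energy enters through the coefficient
only; neither the period nor the solution \<open>p\<close> has to be followed as \<open>E\<close> varies. In polar coordinates
\<open>w = e\<^sup>\<rho> sin \<theta>\<close>, \<open>v = e\<^sup>\<rho> cos \<theta>\<close> the angle obeys \<open>\<theta>' = a (cos\<^sup>2 \<theta> + q sin\<^sup>2 \<theta>)\<close>. This vector field is
globally Lipschitz, hence has global solutions, continuous in \<open>E\<close>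
(\<open>global_flow_continuous_in_parameter\<close>), from which \<open>w\<close>, \<open>v\<close> and the continuity of \<open>\<tau>\<close> are recovered.

At high energy \<open>a\<close> is almost constant and small, so over one period every initial angle advances by
about \<open>a\<close> times \<open>2\<pi> (cos\<^sup>2 \<theta>\<^sub>0 + 2\<kappa> sin\<^sup>2 \<theta>\<^sub>0)\<close>, because \<open>V''\<close> has mean zero. This advance is positive,
as \<open>\<kappa> > 0\<close>, and less than \<open>\<pi>\<close> (\<open>rotation_at_high_energy\<close>); no direction is mapped to itself, and
\<open>\<bar>\<tau>\<bar> < 2\<close> (\<open>elliptic_if_every_direction_rotates\<close>).

As \<open>E\<close> tends to 0 the solution spends a time of order \<open>ln (1/E)\<close> near the maximum of \<open>V\<close>, where
\<open>q\<close> is positive because \<open>2\<kappa> + V''(\<pi>) > 0\<close>; the angle therefore grows beyond all bounds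
(\<open>angle_unbounded_near_zero_energy\<close>). By continuity the angle that starts at 0 ends at every large multiple
\<open>n \<pi>\<close> for suitable arbitrarily small energies. There the Floquet matrix is triangular with reciprocal
diagonal entries of sign \<open>(-1)\<^sup>n\<close>, so \<open>\<tau> \<ge> 2\<close> for even and \<open>\<tau> \<le> - 2\<close> for odd \<open>n\<close>
(\<open>trace_at_half_turn\<close>), and \<open>\<tau>\<close> vanishes somewhere in between.\<close>

section \<open>Global solutions that depend continuously on a parameter\<close>

text \<open>Integration from 0 to \<open>x\<close> multiplies the weight \<open>exp (2 K \<bar>x\<bar>)\<close> by at most \<open>1 / (2 K)\<close>. The factor \<open>1 / K\<close>
compensates the Lipschitz constant \<open>K\<close>, and the remaining factor \<open>1 / 2\<close> makes the Picard operator below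
a contraction on the whole line at once. The integral is written over the unit interval, which treats
both signs of \<open>x\<close> alike.\<close>

lemma exp_weight_integral_bound:
  fixes g :: "real \<Rightarrow> 'b::banach"
  assumes K: "0 < K" and C: "0 \<le> C" and g: "continuous_on {0..1} g"
    and bound: "\<And>u. 0 \<le> u \<Longrightarrow> u \<le> 1 \<Longrightarrow> norm (g u) \<le> C * K * exp (2 * K * \<bar>x * u\<bar>)"
  shows "norm (x *\<^sub>R integral {0..1} g) \<le> C / 2 * exp (2 * K * \<bar>x\<bar>)"
proof -
  have "((\<lambda>u. \<bar>x\<bar> * (C * K * exp (2 * K * \<bar>x\<bar> * u))) has_integral
      C / 2 * exp (2 * K * \<bar>x\<bar> * 1) - C / 2 * exp (2 * K * \<bar>x\<bar> * 0)) {0..1}"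
    by (intro fundamental_theorem_of_calculus)
      (auto intro!: derivative_eq_intros simp: has_real_derivative_iff_has_vector_derivative[symmetric])
  then have I: "((\<lambda>u. \<bar>x\<bar> * (C * K * exp (2 * K * \<bar>x\<bar> * u))) has_integral
      C / 2 * exp (2 * K * \<bar>x\<bar>) - C / 2) {0..1}"
    by simp
  have "norm (integral {0..1} (\<lambda>u. x *\<^sub>R g u)) \<le>
      integral {0..1} (\<lambda>u. \<bar>x\<bar> * (C * K * exp (2 * K * \<bar>x\<bar> * u)))"
  proof (rule integral_norm_bound_integral)
    show "(\<lambda>u. x *\<^sub>R g u) integrable_on {0..1}"
      by (intro integrable_continuous_interval continuous_intros g)
    show "(\<lambda>u. \<bar>x\<bar> * (C * K * exp (2 * K * \<bar>x\<bar> * u))) integrable_on {0..1}"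
      using I by blast
    fix u :: real assume "u \<in> {0..1}"
    then show "norm (x *\<^sub>R g u) \<le> \<bar>x\<bar> * (C * K * exp (2 * K * \<bar>x\<bar> * u))"
      using bound[of u] by (auto simp: abs_mult mult.assoc intro!: mult_left_mono)
  qed
  also have "\<dots> \<le> C / 2 * exp (2 * K * \<bar>x\<bar>)"
    using C by (simp only: integral_unique[OF I])
  finally show ?thesis by simp
qed

text \<open>The expression is the integral of \<open>g\<close> from 0 to \<open>x\<close>, in a form that is meaningful for negative \<open>x\<close> and
whose domain of integration does not vary.\<close>

lemma scaled_integral_has_vector_derivative:
  fixes g :: "real \<Rightarrow> 'b::banach"
  assumes g: "continuous_on UNIV g"
  shows "((\<lambda>x. x *\<^sub>R integral {0..1} (\<lambda>u. g (x * u))) has_vector_derivative g x) (at x)"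
proof -
  (* Continuous functions have antiderivatives on bounded intervals; this one has x in its interior. *)
  define N where "N = \<bar>x\<bar> + 1"
  obtain G where G: "\<And>y. y \<in> {-N..N} \<Longrightarrow> (G has_vector_derivative g y) (at y within {-N..N})"
    using antiderivative_continuous[OF continuous_on_subset[OF g subset_UNIV]] by blast
  have eq: "y *\<^sub>R integral {0..1} (\<lambda>u. g (y * u)) = G y - G 0" if y: "y \<in> {-N<..<N}" for y
  proof -
    have rng: "(\<lambda>u. y * u) ` {0..1} \<subseteq> {-N..N}"
    proof
      fix z assume "z \<in> (\<lambda>u. y * u) ` {0..1}"
      then obtain u where u: "z = y * u" "0 \<le> u" "u \<le> 1" by (elim imageE) auto
      have "\<bar>z\<bar> \<le> \<bar>y\<bar>" using u by (simp add: abs_mult mult_left_le)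
      then show "z \<in> {-N..N}" using y by auto
    qed
    have "((\<lambda>u. y *\<^sub>R g (y * u)) has_integral G (y * 1) - G (y * 0)) {0..1}"
    proof (rule fundamental_theorem_of_calculus)
      fix u :: real assume u: "u \<in> {0..1}"
      have "(G has_vector_derivative g (y * u)) (at (y * u) within (\<lambda>u. y * u) ` {0..1})"
        by (rule has_vector_derivative_within_subset[OF G rng]) (use rng u in blast)
      then have "((G \<circ> (\<lambda>u. y * u)) has_vector_derivative y *\<^sub>R g (y * u)) (at u within {0..1})"
        by (intro vector_diff_chain_within) (auto intro!: derivative_eq_intros)
      then show "((\<lambda>u. G (y * u)) has_vector_derivative y *\<^sub>R g (y * u)) (at u within {0..1})"
        by (simp add: o_def)
    qed simp
    from integral_unique[OF this] show ?thesis by simp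
  qed
  have x: "x \<in> {-N<..<N}" by (auto simp: N_def)
  have sub: "{-N<..<N} \<subseteq> {-N..N}" by auto
  have "(G has_vector_derivative g x) (at x)"
    using has_vector_derivative_within_subset[OF G[OF subsetD[OF sub x]] sub] at_within_open[OF x] by simp
  then have "((\<lambda>y. G y - G 0) has_vector_derivative g x) (at x)"
    by (auto intro!: derivative_eq_intros)
  then show ?thesis
    by (rule has_vector_derivative_transform_within_open[of _ _ _ "{-N<..<N}"]) (use eq x in auto)
qed

text \<open>Picard--Lindeloef for a field with a global Lipschitz constant that may depend on the parameter. The
Picard operator is a contraction on bounded continuous functions of parameter and time together,
after division by the weight \<open>exp (2 K e \<bar>x\<bar>)\<close>, so one application of the fixed point theorem gives global
solutions that are jointly continuous.\<close>

lemma global_flow_continuous_in_parameter: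
  fixes f :: "'p::metric_space \<Rightarrow> real \<Rightarrow> 'b::banach \<Rightarrow> 'b"
  assumes f: "continuous_on UNIV (\<lambda>(e, x, y). f e x y)"
    and K: "continuous_on UNIV K" "\<And>e. 0 < K e"
    and lip: "\<And>e x y z. norm (f e x y - f e x z) \<le> K e * norm (y - z)"
    and f0: "\<And>e x. norm (f e x 0) \<le> K e"
  obtains Y where "continuous_on UNIV (\<lambda>(e, x). Y e x)" "\<And>e. Y e 0 = y\<^sub>0"
    "\<And>e x. (Y e has_vector_derivative f e x (Y e x)) (at x)"
proof -
  define w where "w e x = exp (2 * K e * \<bar>x\<bar>)" for e x
  have w_pos: "w e x > 0" and w_ge1: "w e x \<ge> 1" for e x
    using K(2)[of e] by (auto simp: w_def)
  have K_comp: "continuous_on S (\<lambda>x. K (h x))" if "continuous_on S h"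
    for S :: "'c::topological_space set" and h
    using continuous_on_compose2[OF K(1) that] by auto
  have f_comp: "continuous_on S (\<lambda>x. f (h x) (k x) (l x))"
    if "continuous_on S h" "continuous_on S k" "continuous_on S l"
    for S :: "'c::topological_space set" and h k l
    using continuous_on_compose2[OF f continuous_on_Pair[OF that(1) continuous_on_Pair[OF that(2,3)]]]
    by simp
  (* The unknown is U = Y / w; g is the field along the curve w U. *)
  define g where "g U e s = f e s (w e s *\<^sub>R apply_bcontfun U (e, s))"
    for U :: "('p \<times> real) \<Rightarrow>\<^sub>C 'b" and e s
  have g_comp: "continuous_on S (\<lambda>x. g U (h x) (k x))"
    if "continuous_on S h" "continuous_on S k"
    for S :: "'c::topological_space set" and h k U
    unfolding g_def w_def
    by (intro f_comp that continuous_intros K_comp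
        continuous_on_compose2[OF continuous_on_apply_bcontfun[of UNIV]]) auto
  define \<Phi> where "\<Phi> U = (\<lambda>(e, x). (1 / w e x) *\<^sub>R (y\<^sub>0 + x *\<^sub>R integral {0..1} (\<lambda>u. g U e (x * u))))" for U
  have g_bound: "norm (g U e s) \<le> (1 + norm U) * K e * exp (2 * K e * \<bar>s\<bar>)" for U e s
  proof -
    have "norm (g U e s) \<le> norm (g U e s - f e s 0) + norm (f e s 0)"
      using norm_triangle_ineq[of "g U e s - f e s 0" "f e s 0"] by simp
    also have "\<dots> \<le> K e * norm (w e s *\<^sub>R apply_bcontfun U (e, s)) + K e"
      unfolding g_def using lip[of e s _ 0] f0[of e s] by (metis add_mono diff_zero)
    also have "\<dots> \<le> K e * (w e s * norm U) + K e * w e s"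
      using w_ge1[of e s] K(2)[of e] norm_bounded[of U "(e, s)"] w_pos[of e s]
      by (intro add_mono mult_left_mono) (auto intro: mult_left_mono)
    also have "\<dots> = (1 + norm U) * K e * exp (2 * K e * \<bar>s\<bar>)"
      by (simp add: w_def algebra_simps)
    finally show ?thesis .
  qed
  have \<Phi>_bcont: "\<Phi> U \<in> bcontfun" for U
  proof (rule bcontfun_normI)
    have "continuous_on UNIV (\<lambda>z. integral (cbox 0 1) (\<lambda>u. g U (fst z) (snd z * u)))"
      by (rule integral_continuous_on_param) (auto simp: case_prod_beta intro!: continuous_intros g_comp)
    then show "continuous_on UNIV (\<Phi> U)"
      unfolding \<Phi>_def case_prod_beta w_def
      by (intro continuous_intros K_comp) auto
    fix z :: "'p \<times> real"
    obtain e x where z: "z = (e, x)" by fastforce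
    have "norm (x *\<^sub>R integral {0..1} (\<lambda>u. g U e (x * u))) \<le> (1 + norm U) / 2 * w e x"
      unfolding w_def
      by (rule exp_weight_integral_bound) (use K g_bound in \<open>auto intro!: g_comp continuous_intros\<close>)
    then have "norm (y\<^sub>0 + x *\<^sub>R integral {0..1} (\<lambda>u. g U e (x * u))) \<le> norm y\<^sub>0 + (1 + norm U) / 2 * w e x"
      using norm_triangle_ineq[of y\<^sub>0 "x *\<^sub>R integral {0..1} (\<lambda>u. g U e (x * u))"] by linarith
    also have "\<dots> \<le> norm y\<^sub>0 * w e x + (1 + norm U) / 2 * w e x"
      using w_ge1[of e x] by (simp add: mult_left_le mult_le_cancel_left1)
    finally have "norm (y\<^sub>0 + x *\<^sub>R integral {0..1} (\<lambda>u. g U e (x * u))) \<le> (norm y\<^sub>0 + (1 + norm U) / 2) * w e x"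
      by (simp add: algebra_simps)
    then show "norm (\<Phi> U z) \<le> norm y\<^sub>0 + (1 + norm U) / 2"
      using w_pos[of e x] by (simp add: \<Phi>_def z pos_divide_le_eq)
  qed
  have contraction: "dist (Bcontfun (\<Phi> U)) (Bcontfun (\<Phi> W)) \<le> 1 / 2 * dist U W" for U W
  proof (rule dist_bound)
    fix z :: "'p \<times> real"
    obtain e x where z: "z = (e, x)" by fastforce
    have g_diff: "norm (g U e s - g W e s) \<le> dist U W * K e * exp (2 * K e * \<bar>s\<bar>)" for s
    proof -
      have "norm (g U e s - g W e s) \<le> K e * (w e s * dist (apply_bcontfun U (e, s)) (apply_bcontfun W (e, s)))"
        unfolding g_def using lip[of e s "w e s *\<^sub>R apply_bcontfun U (e, s)" "w e s *\<^sub>R apply_bcontfun W (e, s)"] w_pos[of e s]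
        by (simp add: dist_norm flip: scaleR_diff_right)
      also have "\<dots> \<le> K e * (w e s * dist U W)"
        using K(2)[of e] w_pos[of e s] dist_bounded[of U "(e, s)" W] by (intro mult_left_mono) auto
      finally show ?thesis by (simp add: w_def algebra_simps)
    qed
    have "x *\<^sub>R integral {0..1} (\<lambda>u. g U e (x * u)) - x *\<^sub>R integral {0..1} (\<lambda>u. g W e (x * u))
        = x *\<^sub>R integral {0..1} (\<lambda>u. g U e (x * u) - g W e (x * u))"
      by (subst integral_diff)
        (auto intro!: integrable_continuous_interval g_comp continuous_intros simp: scaleR_diff_right)
    moreover have "norm (x *\<^sub>R integral {0..1} (\<lambda>u. g U e (x * u) - g W e (x * u))) \<le> dist U W / 2 * w e x"
      unfolding w_def
      by (rule exp_weight_integral_bound) (use K g_diff in \<open>auto intro!: g_comp continuous_intros\<close>)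
    ultimately have "norm (x *\<^sub>R integral {0..1} (\<lambda>u. g U e (x * u)) - x *\<^sub>R integral {0..1} (\<lambda>u. g W e (x * u))) \<le> dist U W / 2 * w e x"
      by simp
    then have "dist (\<Phi> U z) (\<Phi> W z) \<le> 1 / 2 * dist U W"
      using w_pos[of e x]
      by (simp add: \<Phi>_def z dist_norm pos_divide_le_eq flip: scaleR_diff_right)
    then show "dist (apply_bcontfun (Bcontfun (\<Phi> U)) z) (apply_bcontfun (Bcontfun (\<Phi> W)) z) \<le> 1 / 2 * dist U W"
      by (simp add: Bcontfun_inverse[OF \<Phi>_bcont])
  qed
  obtain U where U: "Bcontfun (\<Phi> U) = U"
    using banach_fix_type[of "1/2" "\<lambda>U. Bcontfun (\<Phi> U)"] contraction by auto
  define Y where "Y e x = w e x *\<^sub>R apply_bcontfun U (e, x)" for e x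
  have Y_eq: "Y e x = y\<^sub>0 + x *\<^sub>R integral {0..1} (\<lambda>u. f e (x * u) (Y e (x * u)))" for e x
  proof -
    have "apply_bcontfun U (e, x) = \<Phi> U (e, x)"
      using U Bcontfun_inverse[OF \<Phi>_bcont] by metis
    then show ?thesis
      using w_pos[of e x] by (simp add: Y_def \<Phi>_def g_def)
  qed
  show thesis
  proof
    show "continuous_on UNIV (\<lambda>(e, x). Y e x)"
      unfolding Y_def w_def case_prod_beta
      by (intro continuous_intros K_comp) auto
    show "Y e 0 = y\<^sub>0" for e
      using Y_eq[of e 0] by simp
    show "(Y e has_vector_derivative f e x (Y e x)) (at x)" for e x
    proof -
      have "continuous_on UNIV (\<lambda>s. f e s (Y e s))"
        using g_comp[of UNIV "\<lambda>_. e" "\<lambda>s. s" U] by (simp add: g_def Y_def)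
      from has_vector_derivative_add[OF has_vector_derivative_const scaled_integral_has_vector_derivative[OF this]]
      have "((\<lambda>x. y\<^sub>0 + x *\<^sub>R integral {0..1} (\<lambda>u. f e (x * u) (Y e (x * u)))) has_vector_derivative
          f e x (Y e x)) (at x)"
        by simp
      then show ?thesis
        unfolding Y_eq[of e, symmetric] .
    qed
  qed
qed

section \<open>Comparison of rates and periodic functions\<close>

lemma nondecreasing_difference:
  fixes f g :: "real \<Rightarrow> real"
  assumes "a \<le> b"
    and f: "\<And>x. a \<le> x \<Longrightarrow> x \<le> b \<Longrightarrow> (f has_real_derivative f' x) (at x)"
    and g: "\<And>x. a \<le> x \<Longrightarrow> x \<le> b \<Longrightarrow> (g has_real_derivative g' x) (at x)"
    and le: "\<And>x. a \<le> x \<Longrightarrow> x \<le> b \<Longrightarrow> g' x \<le> f' x"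
  shows "g b - g a \<le> f b - f a"
proof -
  have "f a - g a \<le> f b - g b"
  proof (rule DERIV_nonneg_imp_nondecreasing[OF \<open>a \<le> b\<close>])
    fix x assume "a \<le> x" "x \<le> b"
    then show "\<exists>y. ((\<lambda>x. f x - g x) has_real_derivative y) (at x) \<and> 0 \<le> y"
      using f g le by (intro exI[of _ "f' x - g' x"]) (auto intro: DERIV_diff)
  qed
  then show ?thesis by simp
qed

lemma periodic_continuous_bounded:
  fixes f :: "real \<Rightarrow> real"
  assumes cont: "continuous_on UNIV f" and per: "\<And>x. f (x + c) = f x" and c: "0 < c"
  obtains B where "0 < B" "\<And>x. \<bar>f x\<bar> \<le> B"
proof -
  interpret periodic_fun_simple f c
    by unfold_locales (rule per)
  have "bounded (f ` {0..c})"
    by (intro compact_imp_bounded compact_continuous_image continuous_on_subset[OF cont]) auto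
  then obtain B where B: "0 < B" "\<And>y. y \<in> {0..c} \<Longrightarrow> \<bar>f y\<bar> \<le> B"
    unfolding bounded_pos by auto
  have "\<bar>f x\<bar> \<le> B" for x
  proof -
    define y where "y = x + of_int (- \<lfloor>x / c\<rfloor>) * c"
    have "y \<in> {0..c}"
      using floor_divide_lower[OF c, of x] floor_divide_upper[OF c, of x] by (auto simp: y_def algebra_simps)
    moreover have "f y = f x"
      unfolding y_def by (rule plus_of_int)
    ultimately show ?thesis
      using B(2)[of y] by simp
  qed
  with B(1) show thesis by (rule that)
qed

section \<open>Planar linear systems and their Floquet matrices\<close>

text \<open>Stated with two coefficients so as to cover both Hill's equation in time (\<open>a = 1\<close>, \<open>b = q\<close>) and its form
with the position as independent variable.\<close>

lemma wronskian_constant: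
  fixes w\<^sub>1 v\<^sub>1 w\<^sub>2 v\<^sub>2 a b :: "real \<Rightarrow> real"
  assumes "\<And>x. (w\<^sub>1 has_real_derivative a x * v\<^sub>1 x) (at x)" "\<And>x. (v\<^sub>1 has_real_derivative - b x * w\<^sub>1 x) (at x)"
    and "\<And>x. (w\<^sub>2 has_real_derivative a x * v\<^sub>2 x) (at x)" "\<And>x. (v\<^sub>2 has_real_derivative - b x * w\<^sub>2 x) (at x)"
  shows "w\<^sub>1 x * v\<^sub>2 x - v\<^sub>1 x * w\<^sub>2 x = w\<^sub>1 0 * v\<^sub>2 0 - v\<^sub>1 0 * w\<^sub>2 0"
proof -
  have "((\<lambda>x. w\<^sub>1 x * v\<^sub>2 x - v\<^sub>1 x * w\<^sub>2 x) has_real_derivative 0) (at x)" for x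
  proof -
    have "((\<lambda>x. w\<^sub>1 x * v\<^sub>2 x - v\<^sub>1 x * w\<^sub>2 x) has_real_derivative
        (a x * v\<^sub>1 x * v\<^sub>2 x + - b x * w\<^sub>2 x * w\<^sub>1 x) - (- b x * w\<^sub>1 x * w\<^sub>2 x + a x * v\<^sub>2 x * v\<^sub>1 x)) (at x)"
      by (intro DERIV_diff DERIV_mult assms)
    then show ?thesis by (simp add: algebra_simps)
  qed
  then show ?thesis
    using DERIV_isconst_all[of "\<lambda>x. w\<^sub>1 x * v\<^sub>2 x - v\<^sub>1 x * w\<^sub>2 x" x 0] by blast
qed

text \<open>The solution is read off from its Wronskians with the fundamental solutions. This contains the
uniqueness for initial value problems, without any estimate.\<close>

lemma fundamental_superposition:
  fixes w v w\<^sub>1 v\<^sub>1 w\<^sub>2 v\<^sub>2 a b :: "real \<Rightarrow> real"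
  assumes sol: "\<And>x. (w has_real_derivative a x * v x) (at x)" "\<And>x. (v has_real_derivative - b x * w x) (at x)"
    and sol1: "\<And>x. (w\<^sub>1 has_real_derivative a x * v\<^sub>1 x) (at x)" "\<And>x. (v\<^sub>1 has_real_derivative - b x * w\<^sub>1 x) (at x)"
    and sol2: "\<And>x. (w\<^sub>2 has_real_derivative a x * v\<^sub>2 x) (at x)" "\<And>x. (v\<^sub>2 has_real_derivative - b x * w\<^sub>2 x) (at x)"
    and init: "w\<^sub>1 0 = 1" "v\<^sub>1 0 = 0" "w\<^sub>2 0 = 0" "v\<^sub>2 0 = 1"
  shows "w\<^sub>1 x * v\<^sub>2 x - w\<^sub>2 x * v\<^sub>1 x = 1"
    and "w x = w 0 * w\<^sub>1 x + v 0 * w\<^sub>2 x" and "v x = w 0 * v\<^sub>1 x + v 0 * v\<^sub>2 x"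
proof -
  have 12: "w\<^sub>1 x * v\<^sub>2 x - v\<^sub>1 x * w\<^sub>2 x = 1"
    using wronskian_constant[OF sol1 sol2, of x] init by simp
  have 1: "v 0 = v x * w\<^sub>1 x - w x * v\<^sub>1 x"
    using wronskian_constant[OF sol sol1, of x] init by simp
  have 2: "w 0 = w x * v\<^sub>2 x - v x * w\<^sub>2 x"
    using wronskian_constant[OF sol sol2, of x] init by simp
  show "w\<^sub>1 x * v\<^sub>2 x - w\<^sub>2 x * v\<^sub>1 x = 1"
    using 12 by (simp add: mult.commute)
  have "w 0 * w\<^sub>1 x + v 0 * w\<^sub>2 x = w x * (w\<^sub>1 x * v\<^sub>2 x - v\<^sub>1 x * w\<^sub>2 x)"
    and "w 0 * v\<^sub>1 x + v 0 * v\<^sub>2 x = v x * (w\<^sub>1 x * v\<^sub>2 x - v\<^sub>1 x * w\<^sub>2 x)"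
    unfolding 1 2 by (simp_all add: algebra_simps)
  then show "w x = w 0 * w\<^sub>1 x + v 0 * w\<^sub>2 x" and "v x = w 0 * v\<^sub>1 x + v 0 * v\<^sub>2 x"
    by (simp_all add: 12)
qed

lemma mult_mat_vec_2x2:
  assumes "N \<in> carrier_mat 2 2"
  shows "N *\<^sub>v vec_of_list [x, y] =
    vec_of_list [N $$ (0, 0) * x + N $$ (0, 1) * y, N $$ (1, 0) * x + N $$ (1, 1) * y]"
proof (rule eq_vecI)
  fix i assume "i < dim_vec (vec_of_list [N $$ (0, 0) * x + N $$ (0, 1) * y, N $$ (1, 0) * x + N $$ (1, 1) * y])"
  then have "i = 0 \<or> i = 1" by auto
  then show "(N *\<^sub>v vec_of_list [x, y]) $ i =
      vec_of_list [N $$ (0, 0) * x + N $$ (0, 1) * y, N $$ (1, 0) * x + N $$ (1, 1) * y] $ i"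
    using assms by (auto simp: scalar_prod_def numeral_2_eq_2 vec_of_list_index)
qed (use assms in simp)

text \<open>Superposition shows that this matrix advances every solution; conversely the two fundamental
solutions determine the columns of any such matrix.\<close>

lemma floquet_matrix_eq:
  assumes sol1: "hill_solution q w\<^sub>1 v\<^sub>1" and sol2: "hill_solution q w\<^sub>2 v\<^sub>2"
    and init: "w\<^sub>1 0 = 1" "v\<^sub>1 0 = 0" "w\<^sub>2 0 = 0" "v\<^sub>2 0 = 1"
  shows "floquet_matrix q T = mat_of_rows_list 2 [[w\<^sub>1 T, w\<^sub>2 T], [v\<^sub>1 T, v\<^sub>2 T]]"
  unfolding floquet_matrix_def
proof (rule the_equality)
  let ?M = "mat_of_rows_list 2 [[w\<^sub>1 T, w\<^sub>2 T], [v\<^sub>1 T, v\<^sub>2 T]]"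
  have M: "?M \<in> carrier_mat 2 2"
    by (intro carrier_matI) (simp_all add: mat_of_rows_list_def)
  have entries: "?M $$ (0, 0) = w\<^sub>1 T" "?M $$ (0, 1) = w\<^sub>2 T" "?M $$ (1, 0) = v\<^sub>1 T" "?M $$ (1, 1) = v\<^sub>2 T"
    by (simp_all add: mat_of_rows_list_def)
  have as_system: "(w has_real_derivative 1 * v x) (at x)" "(v has_real_derivative - q x * w x) (at x)"
    if "hill_solution q w v" for w v x
    using that by (simp_all add: hill_solution_def)
  have "vec_of_list [w T, v T] = ?M *\<^sub>v vec_of_list [w 0, v 0]" if "hill_solution q w v" for w v
    unfolding mult_mat_vec_2x2[OF M] entries
    using fundamental_superposition(2,3)[OF as_system[OF that] as_system[OF sol1] as_system[OF sol2] init, of T]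
    by (simp add: mult.commute)
  with M show "?M \<in> carrier_mat 2 2 \<and> (\<forall>w v. hill_solution q w v \<longrightarrow>
      vec_of_list [w T, v T] = ?M *\<^sub>v vec_of_list [w 0, v 0])"
    by blast
  fix N assume N: "N \<in> carrier_mat 2 2 \<and> (\<forall>w v. hill_solution q w v \<longrightarrow>
      vec_of_list [w T, v T] = N *\<^sub>v vec_of_list [w 0, v 0])"
  then have NC: "N \<in> carrier_mat 2 2" by blast
  have "vec_of_list [w T, v T] = vec_of_list [N $$ (0, 0) * w 0 + N $$ (0, 1) * v 0, N $$ (1, 0) * w 0 + N $$ (1, 1) * v 0]"
    if "hill_solution q w v" for w v
    using N that unfolding mult_mat_vec_2x2[OF NC] by blast
  then have "[w T, v T] = [N $$ (0, 0) * w 0 + N $$ (0, 1) * v 0, N $$ (1, 0) * w 0 + N $$ (1, 1) * v 0]"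
    if "hill_solution q w v" for w v
    using that by (metis list_vec)
  from this[OF sol1] this[OF sol2] init
  have N_entries: "N $$ (0, 0) = w\<^sub>1 T" "N $$ (0, 1) = w\<^sub>2 T" "N $$ (1, 0) = v\<^sub>1 T" "N $$ (1, 1) = v\<^sub>2 T"
    by simp_all
  show "N = ?M"
  proof (rule eq_matI)
    fix i j assume "i < dim_row ?M" "j < dim_col ?M"
    then have "i = 0 \<or> i = 1" "j = 0 \<or> j = 1" using M by auto
    then show "N $$ (i, j) = ?M $$ (i, j)"
      using entries N_entries by auto
  qed (use NC M in auto)
qed

section \<open>Eigenvalues of unimodular two by two matrices\<close>

lemma det_2x2:
  fixes A :: "'a::comm_ring_1 mat"
  assumes A: "A \<in> carrier_mat 2 2"
  shows "det A = A $$ (0, 0) * A $$ (1, 1) - A $$ (0, 1) * A $$ (1, 0)"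
proof -
  have minor: "det (mat_delete A 0 j) = mat_delete A 0 j $$ (0, 0)" for j
    using A by (intro det_single mat_delete_carrier[of _ 1 1, simplified]) auto
  show ?thesis
    using A by (simp add: laplace_expansion_row[OF A, of 0] cofactor_def minor numeral_2_eq_2)
      (simp add: mat_delete_def)
qed

lemma spectrum_2x2_unimodular:
  fixes a b c d :: real
  assumes "a * d - b * c = 1"
  shows "spectrum (map_mat complex_of_real (mat_of_rows_list 2 [[a, b], [c, d]]))
     = {l. l\<^sup>2 - complex_of_real (a + d) * l + 1 = 0}"
proof -
  define A where "A = map_mat complex_of_real (mat_of_rows_list 2 [[a, b], [c, d]])"
  have A: "A \<in> carrier_mat 2 2"
    by (intro carrier_matI) (simp_all add: A_def mat_of_rows_list_def)
  have "det (char_matrix A l) = l\<^sup>2 - complex_of_real (a + d) * l + 1" for l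
  proof -
    have "char_matrix A l \<in> carrier_mat 2 2"
      using A by simp
    then have "det (char_matrix A l)
        = (complex_of_real a - l) * (complex_of_real d - l) - complex_of_real b * complex_of_real c"
      by (simp add: det_2x2 char_matrix_def A_def mat_of_rows_list_def)
    also have "\<dots> = l\<^sup>2 - complex_of_real (a + d) * l + complex_of_real (a * d - b * c)"
      by (simp add: algebra_simps power2_eq_square)
    finally show ?thesis
      by (simp add: assms)
  qed
  then show ?thesis
    unfolding A_def[symmetric] spectrum_def using eigenvalue_det[OF A] by auto
qed

text \<open>A root cannot be real, since the discriminant is negative; the imaginary part of the equation then
fixes the real part as \<open>\<tau> / 2\<close>, and the real part of the equation says that the modulus is 1.\<close>

lemma reciprocal_roots_elliptic:
  fixes l :: complex and \<tau> :: real
  assumes "\<bar>\<tau>\<bar> < 2" and root: "l\<^sup>2 - complex_of_real \<tau> * l + 1 = 0"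
  shows "cmod l = 1" "l \<noteq> 1" "l \<noteq> -1"
proof -
  obtain x y where l: "l = Complex x y" by (cases l)
  have re: "x\<^sup>2 - y\<^sup>2 - \<tau> * x + 1 = 0" and im: "2 * x * y = \<tau> * y"
    using root by (auto simp: l complex_eq_iff power2_eq_square algebra_simps)
  have \<tau>: "\<tau>\<^sup>2 < 4"
    using assms(1) abs_square_less_1[of "\<tau> / 2"] by (simp add: power_divide)
  have y: "y \<noteq> 0"
  proof
    assume "y = 0"
    then have "(2 * x - \<tau>)\<^sup>2 = \<tau>\<^sup>2 - 4"
      using re by (simp add: power2_eq_square algebra_simps)
    with \<tau> show False
      using zero_le_power2[of "2 * x - \<tau>"] by linarith
  qed
  with im have "\<tau> = 2 * x" by simp
  with re have "x\<^sup>2 + y\<^sup>2 = 1"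
    by (simp add: power2_eq_square algebra_simps)
  then show "cmod l = 1" by (simp add: l cmod_def)
  show "l \<noteq> 1" "l \<noteq> -1"
    using y by (auto simp: l complex_eq_iff)
qed

lemma reciprocal_roots_hyperbolic:
  fixes \<tau> :: real
  assumes "2 \<le> \<bar>\<tau>\<bar>"
  obtains r :: real where "r \<noteq> 0"
    "{l. l\<^sup>2 - complex_of_real \<tau> * l + 1 = 0} = {complex_of_real r, complex_of_real (inverse r)}"
proof -
  have "2\<^sup>2 \<le> \<bar>\<tau>\<bar>\<^sup>2"
    using assms by (intro power_mono) auto
  then have disc: "0 \<le> \<tau>\<^sup>2 - 4" by simp
  define r where "r = (\<tau> + sqrt (\<tau>\<^sup>2 - 4)) / 2"
  have r: "r * (\<tau> - r) = 1"
    using disc by (simp add: r_def field_simps power2_eq_square)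
  then have "r \<noteq> 0" by auto
  with r have inv: "inverse r = \<tau> - r"
    by (simp add: field_simps)
  have "l\<^sup>2 - complex_of_real \<tau> * l + 1 = (l - complex_of_real r) * (l - complex_of_real (inverse r))" for l
  proof -
    have "complex_of_real r * complex_of_real (\<tau> - r) = 1"
      using r by (metis of_real_1 of_real_mult)
    then show ?thesis
      unfolding inv by (simp add: algebra_simps power2_eq_square)
  qed
  with \<open>r \<noteq> 0\<close> show thesis
    by (intro that[of r]) auto
qed

section \<open>Running solutions\<close>

locale synchronous_pendula =
  fixes V :: "real \<Rightarrow> real" and \<kappa> :: real
  assumes C2: "C2_function V"
    and V_periodic: "\<And>x. V (x + 2 * pi) = V x"
    and V_nonpos: "\<And>x. V x \<le> 0"
    and V_pi: "V pi = 0"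
    and curvature: "deriv (deriv V) pi < 0"
    and V_neg: "\<And>x. (\<forall>k::int. x \<noteq> pi + 2 * pi * of_int k) \<Longrightarrow> V x < 0"
    and coupling: "2 * \<kappa> > - deriv (deriv V) pi"
begin

lemma V_has_derivative: "(V has_real_derivative deriv V x) (at x)"
  using C2 DERIV_deriv_iff_real_differentiable unfolding C2_function_def by blast

lemma V'_has_derivative: "(deriv V has_real_derivative deriv (deriv V) x) (at x)"
  using C2 DERIV_deriv_iff_real_differentiable unfolding C2_function_def by blast

lemma V_continuous: "continuous_on S V"
  using V_has_derivative DERIV_continuous continuous_at_imp_continuous_on by blast

lemma V''_continuous: "continuous_on S (deriv (deriv V))"
  using C2 unfolding C2_function_def using continuous_on_subset by blast

lemma V'_periodic: "deriv V (x + 2 * pi) = deriv V x"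
proof -
  have "((\<lambda>x. V (x + 2 * pi)) has_real_derivative deriv V (x + 2 * pi)) (at x)"
    using V_has_derivative[of "x + 2 * pi"] by (simp add: DERIV_shift)
  then show ?thesis
    using V_has_derivative[of x] DERIV_unique by (auto simp: V_periodic)
qed

lemma V''_periodic: "deriv (deriv V) (x + 2 * pi) = deriv (deriv V) x"
proof -
  have "((\<lambda>x. deriv V (x + 2 * pi)) has_real_derivative deriv (deriv V) (x + 2 * pi)) (at x)"
    using V'_has_derivative[of "x + 2 * pi"] by (simp add: DERIV_shift)
  then show ?thesis
    using V'_has_derivative[of x] DERIV_unique by (auto simp: V'_periodic)
qed

lemma V_bounded: obtains B where "0 < B" "\<And>x. - B \<le> V x"
proof -
  obtain B where "0 < B" "\<And>x. \<bar>V x\<bar> \<le> B"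
    using periodic_continuous_bounded[OF V_continuous V_periodic] by auto
  then show thesis using that[of B] abs_le_D2 minus_le_iff by blast
qed

lemma V''_bounded: obtains B where "0 < B" "\<And>x. \<bar>deriv (deriv V) x\<bar> \<le> B"
  using periodic_continuous_bounded[OF V''_continuous V''_periodic] by auto

lemma coupling_pos: "0 < \<kappa>"
  using coupling curvature by linarith

text \<open>The time needed per unit of position along the running solution of energy \<open>E\<close>.\<close>

definition slowness :: "real \<Rightarrow> real \<Rightarrow> real" where
  "slowness E x = 1 / sqrt (2 * (E - V x))"

text \<open>The time at which the running solution of energy \<open>E\<close> passes the position \<open>x\<close>, that is, the integral of the
slowness from 0 to \<open>x\<close>.\<close>

definition clock :: "real \<Rightarrow> real \<Rightarrow> real" where
  "clock E x = x * integral {0..1} (\<lambda>u. slowness E (x * u))"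

context
  fixes E :: real
  assumes E: "0 < E"
begin

lemma kinetic_pos: "0 < E - V x"
  using E V_nonpos[of x] by linarith

lemma slowness_pos: "0 < slowness E x"
  using kinetic_pos[of x] by (simp add: slowness_def)

lemma slowness_continuous: "continuous_on S (slowness E)"
  unfolding slowness_def using kinetic_pos
  by (intro continuous_intros V_continuous) (auto simp: less_le)

lemma clock_has_derivative: "(clock E has_real_derivative slowness E x) (at x)"
  using scaled_integral_has_vector_derivative[OF slowness_continuous, of x]
  unfolding clock_def[abs_def] has_real_derivative_iff_has_vector_derivative by simp

lemma clock_0: "clock E 0 = 0"
  by (simp add: clock_def)

lemma clock_strict_mono: "strict_mono (clock E)"
  unfolding strict_mono_def
  using DERIV_pos_imp_increasing clock_has_derivative slowness_pos by blast

lemma clock_continuous: "continuous_on S (clock E)"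
  using clock_has_derivative DERIV_continuous continuous_at_imp_continuous_on by blast

text \<open>The slowness is bounded below because \<open>V\<close> is, so the clock grows at least linearly in both directions.\<close>

lemma clock_surj: "surj (clock E)"
proof -
  obtain B where B: "0 < B" "\<And>x. - B \<le> V x"
    using V_bounded by blast
  define m where "m = 1 / sqrt (2 * (E + B))"
  have m: "0 < m" using E B by (simp add: m_def)
  have m_le: "m \<le> slowness E x" for x
    using E B(1) B(2)[of x] kinetic_pos[of x] unfolding m_def slowness_def
    by (intro divide_left_mono mult_pos_pos real_sqrt_le_mono) (auto intro!: real_sqrt_gt_zero)
  have mono: "clock E x - m * x \<le> clock E y - m * y" if "x \<le> y" for x y
  proof (rule DERIV_nonneg_imp_nondecreasing[OF that])
    fix z
    have "((\<lambda>x. clock E x - m * x) has_real_derivative slowness E z - m) (at z)"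
      by (auto intro!: derivative_eq_intros clock_has_derivative)
    then show "\<exists>y. ((\<lambda>x. clock E x - m * x) has_real_derivative y) (at z) \<and> 0 \<le> y"
      using m_le[of z] by force
  qed
  have "\<exists>x. clock E x = t" for t
  proof -
    define N where "N = \<bar>t\<bar> / m"
    have N: "0 \<le> N" "m * N = \<bar>t\<bar>" using m by (auto simp: N_def)
    have "clock E (- N) \<le> t" "t \<le> clock E N"
      using mono[of "-N" 0] mono[of 0 N] N clock_0 by auto
    then show ?thesis
      using IVT'[of "clock E" "-N" t N] N clock_continuous by auto
  qed
  then have "t \<in> range (clock E)" for t by (metis rangeI)
  then show ?thesis by blast
qed

lemma clock_inverse_has_derivative:
  assumes p: "\<And>t. clock E (p t) = t"
  shows "(p has_real_derivative sqrt (2 * (E - V (p t)))) (at t)"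
proof -
  have inv: "p (clock E x) = x" for x
    using p[of "clock E x"] strict_mono_eq[OF clock_strict_mono, of "p (clock E x)" x] by blast
  have "isCont p (clock E (p t))"
    by (rule isCont_inverse_function[of 1 "p t" p "clock E"])
      (auto simp: inv intro: DERIV_isCont clock_has_derivative)
  then have "isCont p t" by (simp add: p)
  then have "(p has_real_derivative inverse (slowness E (p t))) (at t)"
    using clock_has_derivative slowness_pos p
    by (intro DERIV_inverse_function[where f = "clock E" and a = "t - 1" and b = "t + 1"]) (auto simp: less_imp_neq[symmetric])
  then show ?thesis
    by (simp add: slowness_def)
qed

text \<open>Energy conservation with positive velocity is the separable equation \<open>p' = 1 / slowness p\<close>. Its solutions
are the inverse functions of the clock, which gives existence and uniqueness together.\<close>

lemma is_running_solution_iff_clock: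
  "is_running_solution V E p \<longleftrightarrow> (\<forall>t. clock E (p t) = t)"
proof
  assume "is_running_solution V E p"
  then obtain v where p0: "p 0 = 0" and v: "\<And>t. (p has_real_derivative v t) (at t)"
      "\<And>t. (v t)\<^sup>2 / 2 + V (p t) = E" "\<And>t. v t > 0"
    unfolding is_running_solution_def by blast
  have "v t = sqrt (2 * (E - V (p t)))" for t
    using v(2)[of t] v(3)[of t] by (intro real_sqrt_unique[symmetric]) auto
  then have "slowness E (p t) * v t = 1" for t
    using kinetic_pos[of "p t"] by (simp add: slowness_def)
  then have "((\<lambda>t. clock E (p t) - t) has_real_derivative 0) (at t)" for t
    using DERIV_chain2[OF clock_has_derivative v(1), of t]
    by (auto intro!: derivative_eq_intros)
  then have "clock E (p t) - t = clock E (p 0) - 0" for t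
    using DERIV_isconst_all[of "\<lambda>t. clock E (p t) - t" t 0] by blast
  then show "\<forall>t. clock E (p t) = t"
    by (simp add: p0 clock_0)
next
  assume p: "\<forall>t. clock E (p t) = t"
  define v where "v t = sqrt (2 * (E - V (p t)))" for t
  have pos: "v t > 0" for t
    using kinetic_pos by (simp add: v_def)
  have p': "(p has_real_derivative v t) (at t)" for t
    unfolding v_def using p by (intro clock_inverse_has_derivative) auto
  have "(v has_real_derivative - deriv V (p t)) (at t)" for t
  proof -
    have "((\<lambda>t. sqrt (2 * (E - V (p t)))) has_real_derivative
        inverse (v t) / 2 * (2 * (0 - deriv V (p t) * v t))) (at t)"
      using kinetic_pos[of "p t"] unfolding v_def
      by (auto intro!: derivative_eq_intros DERIV_chain2[OF V_has_derivative] p'[unfolded v_def])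
    then show ?thesis
      using pos[of t] unfolding v_def by (simp add: field_simps)
  qed
  moreover have "(v t)\<^sup>2 / 2 + V (p t) = E" for t
    using kinetic_pos[of "p t"] by (simp add: v_def field_simps)
  moreover have "p 0 = 0"
    using strict_mono_eq[OF clock_strict_mono, of "p 0" 0] p clock_0 by simp
  ultimately show "is_running_solution V E p"
    unfolding is_running_solution_def using p' pos by blast
qed

lemma clock_running_solution: "clock E (running_solution V E t) = t"
proof -
  obtain p where p: "\<And>t. clock E (p t) = t"
    using surj_f_inv_f[OF clock_surj] by blast
  have "running_solution V E = p"
    unfolding running_solution_def is_running_solution_iff_clock
  proof (rule the_equality)
    fix p' assume "\<forall>t. clock E (p' t) = t"
    then have "clock E (p' t) = clock E (p t)" for t
      by (simp add: p)
    then show "p' = p"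
      using strict_mono_eq[OF clock_strict_mono] by blast
  qed (use p in blast)
  then show ?thesis using p by simp
qed

lemma is_running_solution_running_solution: "is_running_solution V E (running_solution V E)"
  using is_running_solution_iff_clock clock_running_solution by blast

text \<open>The period is defined by an integral over \<open>[-\<pi>, \<pi>]\<close>, but the running solution starts at 0; periodicity of
the slowness allows the shift to \<open>[0, 2\<pi>]\<close>.\<close>

lemma running_period_eq_clock: "running_period V E = clock E (2 * pi)"
proof -
  have "((\<lambda>x. clock E (x + 2 * pi) - clock E x) has_real_derivative 0) (at x)" for x
  proof -
    have "slowness E (x + 2 * pi) = slowness E x"
      by (simp add: slowness_def V_periodic)
    then show ?thesis
      using clock_has_derivative[of "x + 2 * pi"] clock_has_derivative[of x]
      by (auto simp: DERIV_shift intro!: derivative_eq_intros)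
  qed
  then have "clock E (- pi + 2 * pi) - clock E (- pi) = clock E (0 + 2 * pi) - clock E 0"
    using DERIV_isconst_all[of "\<lambda>x. clock E (x + 2 * pi) - clock E x" "-pi" 0] by blast
  then have shift: "clock E pi - clock E (- pi) = clock E (2 * pi)"
    by (simp add: clock_0)
  have "(slowness E has_integral clock E pi - clock E (- pi)) {-pi..pi}"
    by (rule fundamental_theorem_of_calculus)
      (auto simp flip: has_real_derivative_iff_has_vector_derivative
        intro: has_field_derivative_at_within clock_has_derivative)
  then have "integral {-pi..pi} (slowness E) = clock E (2 * pi)"
    using shift by (simp add: integral_unique)
  moreover have "slowness E = (\<lambda>x. 1 / sqrt 2 * (1 / sqrt (E - V x)))"
    unfolding slowness_def[abs_def] real_sqrt_mult by simp
  ultimately show ?thesis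
    unfolding running_period_def by (simp only: integral_mult_right)
qed

lemma running_solution_0: "running_solution V E 0 = 0"
  using strict_mono_eq[OF clock_strict_mono, of "running_solution V E 0" 0]
  by (simp add: clock_running_solution clock_0)

lemma running_solution_period: "running_solution V E (running_period V E) = 2 * pi"
  using strict_mono_eq[OF clock_strict_mono, of "running_solution V E (running_period V E)" "2 * pi"]
  by (simp add: clock_running_solution running_period_eq_clock)

end

lemma synchronous_solves_coupled:
  assumes "0 < E"
  shows "solves_coupled V \<kappa> (running_solution V E) (running_solution V E)"
  using is_running_solution_running_solution[OF assms]
  unfolding is_running_solution_def solves_coupled_def by auto

lemma slowness_le: "0 < E \<Longrightarrow> slowness E x \<le> 1 / sqrt (2 * E)"
  using V_nonpos[of x] kinetic_pos[of E x] unfolding slowness_def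
  by (intro divide_left_mono mult_pos_pos real_sqrt_le_mono) auto

text \<open>With \<open>y = E / (E - V x) \<le> 1\<close> the slowness is \<open>sqrt y / sqrt (2 E)\<close>, and \<open>sqrt y \<ge> y \<ge> 1 - B / E\<close>. Together with
the upper bound this makes the slowness asymptotically constant at high energy.\<close>

lemma slowness_ge:
  assumes E: "0 < E" and B: "- B \<le> V x"
  shows "1 / sqrt (2 * E) * (1 - B / E) \<le> slowness E x"
proof -
  define y where "y = E / (E - V x)"
  have y: "0 < y" "y \<le> 1"
    using E kinetic_pos[OF E, of x] V_nonpos[of x] by (auto simp: y_def divide_le_eq_1)
  have "y - 1 = V x / (E - V x)"
    using kinetic_pos[OF E, of x] by (simp add: y_def field_simps)
  moreover have "V x / E \<le> V x / (E - V x)"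
    using E V_nonpos[of x] by (intro divide_left_mono_neg) auto
  moreover have "- B / E \<le> V x / E"
    using B E by (intro divide_right_mono) auto
  ultimately have "1 - B / E \<le> y" by simp
  also have "y \<le> sqrt y"
    using y by (intro real_le_rsqrt) (simp add: power2_eq_square mult_left_le)
  finally have "1 / sqrt (2 * E) * (1 - B / E) \<le> 1 / sqrt (2 * E) * sqrt y"
    using E by (intro mult_left_mono) auto
  also have "\<dots> = slowness E x"
    unfolding y_def slowness_def real_sqrt_mult real_sqrt_divide using E by simp
  finally show ?thesis .
qed

end

section \<open>Polar coordinates for the transverse equation\<close>

lemma abs_sin_diff_le: "\<bar>sin x - sin y\<bar> \<le> \<bar>x - y\<bar>" for x y :: real
proof -
  have "\<bar>sin x - sin y\<bar> = 2 * \<bar>sin ((x - y) / 2)\<bar> * \<bar>cos ((x + y) / 2)\<bar>"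
    by (simp add: sin_diff_sin abs_mult)
  also have "\<dots> \<le> 2 * \<bar>(x - y) / 2\<bar> * 1"
    by (intro mult_mono abs_sin_x_le_abs_x) auto
  finally show ?thesis by simp
qed

lemma abs_cos_diff_le: "\<bar>cos x - cos y\<bar> \<le> \<bar>x - y\<bar>" for x y :: real
  using abs_sin_diff_le[of "pi / 2 - x" "pi / 2 - y"] by (simp add: sin_cos_eq[symmetric] cos_sin_eq)

text \<open>The double angle makes the Lipschitz constant of the angular rate visible.\<close>

lemma cos2_plus_mult_sin2:
  "(cos u)\<^sup>2 + q * (sin u)\<^sup>2 = (1 + q) / 2 + (1 - q) / 2 * cos (2 * u)" for u q :: real
proof -
  have squares: "(cos u)\<^sup>2 = (1 + cos (2 * u)) / 2" "(sin u)\<^sup>2 = (1 - cos (2 * u)) / 2"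
    using cos_double_cos[of u] cos_double_sin[of u] by simp_all
  show ?thesis unfolding squares by (simp add: field_simps)
qed

lemma cos2_plus_mult_sin2_ge:
  fixes u q m :: real
  assumes "m \<le> 1" "m \<le> q"
  shows "m \<le> (cos u)\<^sup>2 + q * (sin u)\<^sup>2"
proof -
  have "m * ((cos u)\<^sup>2 + (sin u)\<^sup>2) \<le> 1 * (cos u)\<^sup>2 + q * (sin u)\<^sup>2"
    unfolding distrib_left using assms by (intro add_mono mult_right_mono) auto
  then show ?thesis by simp
qed

context synchronous_pendula
begin

text \<open>The coefficient of the transverse equation, as a function of the position.\<close>

definition stiffness :: "real \<Rightarrow> real" where
  "stiffness x = 2 * \<kappa> + deriv (deriv V) x"

lemma stiffness_bounded: obtains Q where "0 < Q" "\<And>x. \<bar>stiffness x\<bar> \<le> Q"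
proof -
  obtain B where B: "0 < B" "\<And>x. \<bar>deriv (deriv V) x\<bar> \<le> B"
    using V''_bounded by blast
  have "\<bar>stiffness x\<bar> \<le> 2 * \<bar>\<kappa>\<bar> + B" for x
    using B(2)[of x] unfolding stiffness_def by linarith
  then show thesis using that[of "2 * \<bar>\<kappa>\<bar> + B"] B(1) by auto
qed

lemma stiffness_continuous: "continuous_on S stiffness"
  unfolding stiffness_def[abs_def] by (intro continuous_intros V''_continuous)

text \<open>The equations for \<open>(\<theta>, \<rho>)\<close> that are equivalent to \<open>w' = slowness * v\<close>, \<open>v' = - slowness * stiffness * w\<close> under
\<open>w = e\<^sup>\<rho> sin \<theta>\<close>, \<open>v = e\<^sup>\<rho> cos \<theta>\<close>.\<close>

definition pruefer_field :: "real \<Rightarrow> real \<Rightarrow> real \<times> real \<Rightarrow> real \<times> real" where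
  "pruefer_field E x = (\<lambda>(\<theta>, \<rho>).
     (slowness E x * ((cos \<theta>)\<^sup>2 + stiffness x * (sin \<theta>)\<^sup>2),
      slowness E x * ((1 - stiffness x) * sin \<theta> * cos \<theta>)))"

lemma pruefer_field_lipschitz:
  assumes E: "0 < E" and Q: "\<And>x. \<bar>stiffness x\<bar> \<le> Q"
  shows "norm (pruefer_field E x y - pruefer_field E x z) \<le> 2 * (1 + Q) / sqrt (2 * E) * norm (y - z)"
proof -
  obtain \<theta> \<rho> \<phi> \<sigma> where y: "y = (\<theta>, \<rho>)" and z: "z = (\<phi>, \<sigma>)"
    by (metis surj_pair)
  define b where "b = slowness E x * (1 - stiffness x) / 2"
  have half_angle: "(1 - stiffness x) * sin u * cos u = (1 - stiffness x) / 2 * sin (2 * u)" for u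
    by (simp add: sin_double)
  have eq: "pruefer_field E x y - pruefer_field E x z
      = (b * (cos (2 * \<theta>) - cos (2 * \<phi>)), b * (sin (2 * \<theta>) - sin (2 * \<phi>)))"
    unfolding pruefer_field_def y z b_def
    by (simp add: cos2_plus_mult_sin2 half_angle) (simp add: field_simps)
  have scale: "\<bar>2 * \<theta> - 2 * \<phi>\<bar> = 2 * \<bar>\<theta> - \<phi>\<bar>"
    by (simp add: abs_if)
  note lip = abs_cos_diff_le[of "2 * \<theta>" "2 * \<phi>", unfolded scale]
    abs_sin_diff_le[of "2 * \<theta>" "2 * \<phi>", unfolded scale]
  have b: "\<bar>b\<bar> * 2 \<le> (1 + Q) / sqrt (2 * E)"
  proof -
    have "\<bar>b\<bar> * 2 = slowness E x * \<bar>1 - stiffness x\<bar>"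
      using slowness_pos[OF E, of x] by (simp add: b_def abs_mult)
    also have "\<dots> \<le> 1 / sqrt (2 * E) * (1 + Q)"
      using Q[of x] E by (intro mult_mono slowness_le) auto
    finally show ?thesis by simp
  qed
  have "norm (pruefer_field E x y - pruefer_field E x z) \<le> \<bar>b\<bar> * (2 * \<bar>\<theta> - \<phi>\<bar>) + \<bar>b\<bar> * (2 * \<bar>\<theta> - \<phi>\<bar>)"
    unfolding eq using lip
    by (intro order_trans[OF norm_Pair_le] add_mono) (auto simp: abs_mult intro!: mult_left_mono)
  also have "\<dots> = 2 * (\<bar>b\<bar> * 2 * \<bar>\<theta> - \<phi>\<bar>)"
    by simp
  also have "\<dots> \<le> 2 * ((1 + Q) / sqrt (2 * E) * \<bar>\<theta> - \<phi>\<bar>)"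
    by (intro mult_left_mono mult_right_mono b) auto
  also have "\<dots> \<le> 2 * ((1 + Q) / sqrt (2 * E) * norm (y - z))"
    using norm_fst_le[of "\<theta> - \<phi>" "\<rho> - \<sigma>"] E Q[of x] unfolding y z
    by (intro mult_left_mono) (auto intro!: divide_nonneg_nonneg)
  finally show ?thesis by (simp add: algebra_simps)
qed

text \<open>The energy is written as \<open>exp e\<close>, so that the parameter ranges over the whole line. The Lipschitz constant
blows up as \<open>E\<close> tends to 0 but is continuous in the parameter, which is enough.\<close>

lemma pruefer_flow_exists:
  "\<exists>Y. (\<forall>x. continuous_on {0<..} (\<lambda>E. Y E x)) \<and>
     (\<forall>E>0. Y E 0 = (\<theta>\<^sub>0, 0) \<and>
        (\<forall>x. (Y E has_vector_derivative pruefer_field E x (Y E x)) (at x)))"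
proof -
  obtain Q where Q: "0 < Q" "\<And>x. \<bar>stiffness x\<bar> \<le> Q"
    using stiffness_bounded by blast
  have "continuous_on UNIV (\<lambda>(e, x, y). pruefer_field (exp e) x y)"
    unfolding pruefer_field_def case_prod_beta slowness_def
    using kinetic_pos[OF exp_gt_zero]
    by (intro continuous_intros continuous_on_compose2[OF V_continuous[of UNIV]]
        continuous_on_compose2[OF stiffness_continuous[of UNIV]]) (auto simp: less_le)
  moreover have "continuous_on UNIV (\<lambda>e. 2 * (1 + Q) / sqrt (2 * exp e))"
    by (intro continuous_intros) auto
  moreover have "0 < 2 * (1 + Q) / sqrt (2 * exp e)" for e :: real
    using Q(1) by simp
  moreover have "norm (pruefer_field (exp e) x 0) \<le> 2 * (1 + Q) / sqrt (2 * exp e)" for e x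
  proof -
    have "norm (pruefer_field (exp e) x 0) = slowness (exp e) x"
      using slowness_pos[of "exp e" x] by (simp add: pruefer_field_def zero_prod_def)
    also have "\<dots> \<le> 1 / sqrt (2 * exp e)"
      by (rule slowness_le) simp
    also have "\<dots> \<le> 2 * (1 + Q) / sqrt (2 * exp e)"
      using Q(1) by (intro divide_right_mono) auto
    finally show ?thesis .
  qed
  ultimately obtain Y where Y: "continuous_on UNIV (\<lambda>(e, x). Y e x)" "\<And>e. Y e 0 = (\<theta>\<^sub>0, 0)"
    "\<And>e x. (Y e has_vector_derivative pruefer_field (exp e) x (Y e x)) (at x)"
    using global_flow_continuous_in_parameter[where f = "\<lambda>e. pruefer_field (exp e)"
        and K = "\<lambda>e. 2 * (1 + Q) / sqrt (2 * exp e)" and y\<^sub>0 = "(\<theta>\<^sub>0, 0)"]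
      pruefer_field_lipschitz[OF exp_gt_zero Q(2)] by metis
  have "continuous_on {0<..} (\<lambda>E. (\<lambda>(e, x). Y e x) (ln E, x))" for x
    by (rule continuous_on_compose2[OF Y(1)]) (auto intro!: continuous_intros)
  moreover have "(Y (ln E) has_vector_derivative pruefer_field E x (Y (ln E) x)) (at x)" if "0 < E" for E x
    using Y(3)[of "ln E" x] that by simp
  ultimately show ?thesis
    using Y(2) by (intro exI[of _ "\<lambda>E. Y (ln E)"]) auto
qed

definition pruefer_flow :: "real \<Rightarrow> real \<Rightarrow> real \<Rightarrow> real \<times> real" where
  "pruefer_flow \<theta>\<^sub>0 = (SOME Y. (\<forall>x. continuous_on {0<..} (\<lambda>E. Y E x)) \<and>
     (\<forall>E>0. Y E 0 = (\<theta>\<^sub>0, 0) \<and>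
        (\<forall>x. (Y E has_vector_derivative pruefer_field E x (Y E x)) (at x))))"

definition angle :: "real \<Rightarrow> real \<Rightarrow> real \<Rightarrow> real" where
  "angle \<theta>\<^sub>0 E x = fst (pruefer_flow \<theta>\<^sub>0 E x)"

definition log_radius :: "real \<Rightarrow> real \<Rightarrow> real \<Rightarrow> real" where
  "log_radius \<theta>\<^sub>0 E x = snd (pruefer_flow \<theta>\<^sub>0 E x)"

lemma pruefer_flow_solves:
  shows "continuous_on {0<..} (\<lambda>E. pruefer_flow \<theta>\<^sub>0 E x)"
    and "0 < E \<Longrightarrow> pruefer_flow \<theta>\<^sub>0 E 0 = (\<theta>\<^sub>0, 0)"
    and "0 < E \<Longrightarrow> (pruefer_flow \<theta>\<^sub>0 E has_vector_derivative
           pruefer_field E x (pruefer_flow \<theta>\<^sub>0 E x)) (at x)"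
  using someI_ex[OF pruefer_flow_exists[of \<theta>\<^sub>0]] unfolding pruefer_flow_def by blast+

lemma angle_continuous: "continuous_on {0<..} (\<lambda>E. angle \<theta>\<^sub>0 E x)"
  unfolding angle_def by (intro continuous_intros pruefer_flow_solves)

lemma log_radius_continuous: "continuous_on {0<..} (\<lambda>E. log_radius \<theta>\<^sub>0 E x)"
  unfolding log_radius_def by (intro continuous_intros pruefer_flow_solves)

context
  fixes E :: real
  assumes E: "0 < E"
begin

lemma angle_0: "angle \<theta>\<^sub>0 E 0 = \<theta>\<^sub>0" and log_radius_0: "log_radius \<theta>\<^sub>0 E 0 = 0"
  by (simp_all add: angle_def log_radius_def pruefer_flow_solves E)

lemma angle_has_derivative:
  "(angle \<theta>\<^sub>0 E has_real_derivative
     slowness E x * ((cos (angle \<theta>\<^sub>0 E x))\<^sup>2 + stiffness x * (sin (angle \<theta>\<^sub>0 E x))\<^sup>2)) (at x)"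
proof -
  have "((\<lambda>x. fst (pruefer_flow \<theta>\<^sub>0 E x)) has_vector_derivative
      fst (pruefer_field E x (pruefer_flow \<theta>\<^sub>0 E x))) (at x)"
    by (rule bounded_linear.has_vector_derivative[OF bounded_linear_fst pruefer_flow_solves(3)[OF E]])
  then show ?thesis
    by (simp add: angle_def[abs_def] pruefer_field_def case_prod_beta has_real_derivative_iff_has_vector_derivative)
qed

lemma log_radius_has_derivative:
  "(log_radius \<theta>\<^sub>0 E has_real_derivative
     slowness E x * ((1 - stiffness x) * sin (angle \<theta>\<^sub>0 E x) * cos (angle \<theta>\<^sub>0 E x))) (at x)"
proof -
  have "((\<lambda>x. snd (pruefer_flow \<theta>\<^sub>0 E x)) has_vector_derivative
      snd (pruefer_field E x (pruefer_flow \<theta>\<^sub>0 E x))) (at x)"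
    by (rule bounded_linear.has_vector_derivative[OF bounded_linear_snd pruefer_flow_solves(3)[OF E]])
  then show ?thesis
    by (simp add: angle_def log_radius_def[abs_def] pruefer_field_def case_prod_beta has_real_derivative_iff_has_vector_derivative)
qed

end

definition displacement :: "real \<Rightarrow> real \<Rightarrow> real \<Rightarrow> real" where
  "displacement \<theta>\<^sub>0 E x = exp (log_radius \<theta>\<^sub>0 E x) * sin (angle \<theta>\<^sub>0 E x)"

definition velocity :: "real \<Rightarrow> real \<Rightarrow> real \<Rightarrow> real" where
  "velocity \<theta>\<^sub>0 E x = exp (log_radius \<theta>\<^sub>0 E x) * cos (angle \<theta>\<^sub>0 E x)"

lemma displacement_has_derivative:
  assumes E: "0 < E"
  shows "(displacement \<theta>\<^sub>0 E has_real_derivative slowness E x * velocity \<theta>\<^sub>0 E x) (at x)"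
proof -
  let ?s = "sin (angle \<theta>\<^sub>0 E x)" and ?c = "cos (angle \<theta>\<^sub>0 E x)" and ?r = "exp (log_radius \<theta>\<^sub>0 E x)"
  let ?D = "?r * (slowness E x * ((1 - stiffness x) * ?s * ?c)) * ?s
      + ?c * (slowness E x * (?c\<^sup>2 + stiffness x * ?s\<^sup>2)) * ?r"
  have "((\<lambda>x. exp (log_radius \<theta>\<^sub>0 E x) * sin (angle \<theta>\<^sub>0 E x)) has_real_derivative ?D) (at x)"
    by (intro derivative_intros angle_has_derivative[OF E] log_radius_has_derivative[OF E])
  moreover have "r * (a * ((1 - q) * s * c)) * s + c * (a * (c\<^sup>2 + q * s\<^sup>2)) * r
      = a * (r * c) * (s\<^sup>2 + c\<^sup>2)" for r a q s c :: real
    by (simp add: algebra_simps power2_eq_square)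
  then have "?D = slowness E x * (?r * ?c)"
    by (simp only: sin_cos_squared_add mult_1_right)
  ultimately show ?thesis
    by (simp add: displacement_def[abs_def] velocity_def)
qed

lemma velocity_has_derivative:
  assumes E: "0 < E"
  shows "(velocity \<theta>\<^sub>0 E has_real_derivative - slowness E x * stiffness x * displacement \<theta>\<^sub>0 E x) (at x)"
proof -
  let ?s = "sin (angle \<theta>\<^sub>0 E x)" and ?c = "cos (angle \<theta>\<^sub>0 E x)" and ?r = "exp (log_radius \<theta>\<^sub>0 E x)"
  let ?D = "?r * (slowness E x * ((1 - stiffness x) * ?s * ?c)) * ?c
      + - ?s * (slowness E x * (?c\<^sup>2 + stiffness x * ?s\<^sup>2)) * ?r"
  have "((\<lambda>x. exp (log_radius \<theta>\<^sub>0 E x) * cos (angle \<theta>\<^sub>0 E x)) has_real_derivative ?D) (at x)"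
    by (intro derivative_intros angle_has_derivative[OF E] log_radius_has_derivative[OF E])
  moreover have "r * (a * ((1 - q) * s * c)) * c + - s * (a * (c\<^sup>2 + q * s\<^sup>2)) * r
      = - a * q * (r * s) * (s\<^sup>2 + c\<^sup>2)" for r a q s c :: real
    by (simp add: algebra_simps power2_eq_square)
  then have "?D = - slowness E x * stiffness x * (?r * ?s)"
    by (simp only: sin_cos_squared_add mult_1_right)
  ultimately show ?thesis
    by (simp add: velocity_def[abs_def] displacement_def)
qed

lemma initial_conditions:
  assumes "0 < E"
  shows "displacement \<theta>\<^sub>0 E 0 = sin \<theta>\<^sub>0" "velocity \<theta>\<^sub>0 E 0 = cos \<theta>\<^sub>0"
  using assms by (simp_all add: displacement_def velocity_def angle_0 log_radius_0)

text \<open>By the chain rule: the velocity of the running solution is the reciprocal of the slowness.\<close>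

lemma hill_solution_along_running_solution:
  assumes E: "0 < E"
  shows "hill_solution (\<lambda>t. stiffness (running_solution V E t))
     (\<lambda>t. displacement \<theta>\<^sub>0 E (running_solution V E t))
     (\<lambda>t. velocity \<theta>\<^sub>0 E (running_solution V E t))"
proof -
  let ?p = "running_solution V E"
  have p': "(?p has_real_derivative sqrt (2 * (E - V (?p t)))) (at t)" for t
    by (rule clock_inverse_has_derivative[OF E clock_running_solution[OF E]])
  show ?thesis
    unfolding hill_solution_def
  proof (intro allI conjI)
    fix t
    have "slowness E (?p t) * velocity \<theta>\<^sub>0 E (?p t) * sqrt (2 * (E - V (?p t))) = velocity \<theta>\<^sub>0 E (?p t)"
      using kinetic_pos[OF E, of "?p t"] by (simp add: slowness_def)
    then show "((\<lambda>t. displacement \<theta>\<^sub>0 E (?p t)) has_real_derivative velocity \<theta>\<^sub>0 E (?p t)) (at t)"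
      using DERIV_chain2[OF displacement_has_derivative[OF E] p', of \<theta>\<^sub>0 t] by (simp only:)
    have "- slowness E (?p t) * stiffness (?p t) * displacement \<theta>\<^sub>0 E (?p t) * sqrt (2 * (E - V (?p t)))
        = - stiffness (?p t) * displacement \<theta>\<^sub>0 E (?p t)"
      using kinetic_pos[OF E, of "?p t"] by (simp add: slowness_def)
    then show "((\<lambda>t. velocity \<theta>\<^sub>0 E (?p t)) has_real_derivative
        - stiffness (?p t) * displacement \<theta>\<^sub>0 E (?p t)) (at t)"
      using DERIV_chain2[OF velocity_has_derivative[OF E] p', of \<theta>\<^sub>0 t] by (simp only:)
  qed
qed

section \<open>Strong stability and the trace of the Floquet matrix\<close>

text \<open>The fundamental solutions starting at \<open>(w, v) = (1, 0)\<close> and \<open>(0, 1)\<close> have the initial angles \<open>\<pi> / 2\<close> and 0.\<close>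

definition floquet_trace :: "real \<Rightarrow> real" where
  "floquet_trace E = displacement (pi / 2) E (2 * pi) + velocity 0 E (2 * pi)"

lemma floquet_trace_continuous: "continuous_on {0<..} floquet_trace"
  unfolding floquet_trace_def[abs_def] displacement_def velocity_def
  by (intro continuous_intros angle_continuous log_radius_continuous)

lemma pruefer_superposition:
  assumes E: "0 < E"
  shows "displacement (pi / 2) E x * velocity 0 E x - displacement 0 E x * velocity (pi / 2) E x = 1"
    and "displacement \<theta>\<^sub>0 E x = sin \<theta>\<^sub>0 * displacement (pi / 2) E x + cos \<theta>\<^sub>0 * displacement 0 E x"
    and "velocity \<theta>\<^sub>0 E x = sin \<theta>\<^sub>0 * velocity (pi / 2) E x + cos \<theta>\<^sub>0 * velocity 0 E x"
proof -
  have v': "(velocity \<theta> E has_real_derivative - (slowness E x * stiffness x) * displacement \<theta> E x) (at x)" for \<theta> x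
    using velocity_has_derivative[OF E] by simp
  note sol = displacement_has_derivative[OF E] v'
  show "displacement (pi / 2) E x * velocity 0 E x - displacement 0 E x * velocity (pi / 2) E x = 1"
    by (rule fundamental_superposition[OF sol[of 0] sol[of "pi / 2"] sol[of 0]]) (simp_all add: initial_conditions[OF E])
  show "displacement \<theta>\<^sub>0 E x = sin \<theta>\<^sub>0 * displacement (pi / 2) E x + cos \<theta>\<^sub>0 * displacement 0 E x"
    using fundamental_superposition(2)[OF sol[of \<theta>\<^sub>0] sol[of "pi / 2"] sol[of 0], of x]
    by (simp add: initial_conditions[OF E])
  show "velocity \<theta>\<^sub>0 E x = sin \<theta>\<^sub>0 * velocity (pi / 2) E x + cos \<theta>\<^sub>0 * velocity 0 E x"
    using fundamental_superposition(3)[OF sol[of \<theta>\<^sub>0] sol[of "pi / 2"] sol[of 0], of x]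
    by (simp add: initial_conditions[OF E])
qed

lemma transverse_eigenvalues_eq:
  assumes E: "0 < E"
  shows "transverse_eigenvalues V \<kappa> E = {l. l\<^sup>2 - complex_of_real (floquet_trace E) * l + 1 = 0}"
proof -
  let ?w = "\<lambda>\<theta>. displacement \<theta> E" and ?v = "\<lambda>\<theta>. velocity \<theta> E" and ?T = "2 * pi"
  have "floquet_matrix (\<lambda>t. stiffness (running_solution V E t)) (running_period V E)
      = mat_of_rows_list 2 [[?w (pi / 2) ?T, ?w 0 ?T], [?v (pi / 2) ?T, ?v 0 ?T]]"
    using floquet_matrix_eq[OF hill_solution_along_running_solution[OF E, of "pi / 2"]
        hill_solution_along_running_solution[OF E, of 0], of "running_period V E"]
    by (simp add: running_solution_0[OF E] running_solution_period[OF E] initial_conditions[OF E])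
  moreover have "?w (pi / 2) ?T * ?v 0 ?T - ?w 0 ?T * ?v (pi / 2) ?T = 1"
    by (rule pruefer_superposition(1)[OF E])
  ultimately show ?thesis
    unfolding transverse_eigenvalues_def stiffness_def[symmetric] floquet_trace_def
    by (simp add: spectrum_2x2_unimodular del: of_real_add)
qed

lemma strongly_stable_iff:
  assumes E: "0 < E"
  shows "strongly_stable V \<kappa> E \<longleftrightarrow> \<bar>floquet_trace E\<bar> < 2"
proof
  assume stable: "strongly_stable V \<kappa> E"
  show "\<bar>floquet_trace E\<bar> < 2"
  proof (rule ccontr)
    assume "\<not> ?thesis"
    then obtain r :: real where r: "transverse_eigenvalues V \<kappa> E = {complex_of_real r, complex_of_real (inverse r)}"
      using reciprocal_roots_hyperbolic[of "floquet_trace E"] transverse_eigenvalues_eq[OF E] by (metis not_less)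
    then have "cmod (complex_of_real r) = 1" "complex_of_real r \<noteq> 1" "complex_of_real r \<noteq> - 1"
      using stable unfolding strongly_stable_def by blast+
    then show False
      by (metis abs_1 abs_eq_iff norm_of_real of_real_1 of_real_minus)
  qed
next
  assume "\<bar>floquet_trace E\<bar> < 2"
  from reciprocal_roots_elliptic[OF this] show "strongly_stable V \<kappa> E"
    unfolding strongly_stable_def transverse_eigenvalues_eq[OF E] by blast
qed

lemma real_eigenvalues_if_not_strongly_stable:
  assumes E: "0 < E" and "\<not> strongly_stable V \<kappa> E"
  shows "\<exists>r::real. r \<noteq> 0 \<and> transverse_eigenvalues V \<kappa> E = {complex_of_real r, complex_of_real (inverse r)}"
proof -
  have "2 \<le> \<bar>floquet_trace E\<bar>"
    using assms(2) strongly_stable_iff[OF E] by linarith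
  then show ?thesis
    unfolding transverse_eigenvalues_eq[OF E] by (rule reciprocal_roots_hyperbolic) blast
qed

text \<open>The area spanned by a vector and its image under the Floquet matrix is a quadratic form in the
vector. If every direction advances by an angle strictly between 0 and \<open>\<pi>\<close>, the form is positive definite,
and its discriminant is \<open>\<tau>\<^sup>2 - 4\<close>.\<close>

lemma elliptic_if_every_direction_rotates:
  assumes E: "0 < E"
    and rot: "\<And>\<theta>\<^sub>0. 0 < angle \<theta>\<^sub>0 E (2 * pi) - \<theta>\<^sub>0 \<and> angle \<theta>\<^sub>0 E (2 * pi) - \<theta>\<^sub>0 < pi"
  shows "\<bar>floquet_trace E\<bar> < 2"
proof -
  define a where "a = displacement (pi / 2) E (2 * pi)"
  define b where "b = displacement 0 E (2 * pi)"
  define c where "c = velocity (pi / 2) E (2 * pi)"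
  define d where "d = velocity 0 E (2 * pi)"
  have det: "a * d - b * c = 1"
    using pruefer_superposition(1)[OF E] by (simp add: a_def b_def c_def d_def)
  have form: "0 < b * (cos \<theta>)\<^sup>2 + (a - d) * sin \<theta> * cos \<theta> - c * (sin \<theta>)\<^sup>2" for \<theta>
  proof -
    have "0 < exp (log_radius \<theta> E (2 * pi)) * sin (angle \<theta> E (2 * pi) - \<theta>)"
      using rot[of \<theta>] by (intro mult_pos_pos sin_gt_zero) auto
    also have "\<dots> = displacement \<theta> E (2 * pi) * cos \<theta> - velocity \<theta> E (2 * pi) * sin \<theta>"
      by (simp add: displacement_def velocity_def sin_diff algebra_simps)
    also have "\<dots> = b * (cos \<theta>)\<^sup>2 + (a - d) * sin \<theta> * cos \<theta> - c * (sin \<theta>)\<^sup>2"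
      unfolding pruefer_superposition(2,3)[OF E, of \<theta>] a_def b_def c_def d_def
      by (simp add: algebra_simps power2_eq_square)
    finally show ?thesis .
  qed
  have c: "c < 0"
    using form[of "pi / 2"] by simp
  (* The direction in which the form, normalised by the square of the cosine, is minimal. *)
  define s where "s = (a - d) / (2 * c)"
  have "sin (arctan s) = s * cos (arctan s)"
    by (simp add: cos_arctan sin_arctan)
  then have "0 < (cos (arctan s))\<^sup>2 * (b + (a - d) * s - c * s\<^sup>2)"
    using form[of "arctan s"] by (simp add: algebra_simps power2_eq_square)
  then have "0 < b + (a - d) * s - c * s\<^sup>2"
    by (simp add: zero_less_mult_iff)
  then have "c * (b + (a - d) * s - c * s\<^sup>2) < 0"
    using c by (simp add: mult_less_0_iff)
  moreover have "4 * (c * (b + (a - d) * s - c * s\<^sup>2)) = 4 * b * c + (a - d)\<^sup>2"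
    using c by (simp add: s_def field_simps power2_eq_square)
  ultimately have "(a + d)\<^sup>2 < 4"
    using det by (simp add: power2_eq_square algebra_simps)
  then have "\<bar>a + d\<bar> < 2"
    using abs_le_square_iff[of 2 "a + d"] by simp
  then show ?thesis
    by (simp add: floquet_trace_def a_def d_def)
qed

text \<open>The vector \<open>(0, 1)\<close> is then mapped to a multiple \<open>d\<close> of itself, so the diagonal entries of the Floquet matrix
are \<open>1 / d\<close> and \<open>d\<close>, where \<open>d\<close> has the sign \<open>(-1)\<^sup>n\<close>; and \<open>\<bar>d + 1 / d\<bar> \<ge> 2\<close>.\<close>

lemma trace_at_half_turn:
  assumes E: "0 < E" and hit: "angle 0 E (2 * pi) = real n * pi"
  shows "even n \<Longrightarrow> 2 \<le> floquet_trace E" and "odd n \<Longrightarrow> floquet_trace E \<le> - 2"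
proof -
  define d where "d = velocity 0 E (2 * pi)"
  have d: "d = exp (log_radius 0 E (2 * pi)) * (-1) ^ n"
    by (simp add: d_def velocity_def hit)
  have "displacement 0 E (2 * pi) = 0"
    by (simp add: displacement_def hit)
  then have inv: "displacement (pi / 2) E (2 * pi) * d = 1"
    using pruefer_superposition(1)[OF E, of "2 * pi"] by (simp add: d_def)
  then have tr: "floquet_trace E * d = 1 + d\<^sup>2"
    unfolding floquet_trace_def d_def[symmetric] by (simp add: distrib_right power2_eq_square)
  show "2 \<le> floquet_trace E" if "even n"
  proof -
    have "0 < d" using that by (simp add: d)
    moreover have "2 * d \<le> floquet_trace E * d"
      unfolding tr using zero_le_power2[of "d - 1"] by (simp add: power2_diff)
    ultimately show ?thesis by simp
  qed
  show "floquet_trace E \<le> - 2" if "odd n"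
  proof -
    have "d < 0" using that by (simp add: d)
    moreover have "(-2) * d \<le> floquet_trace E * d"
      unfolding tr using zero_le_power2[of "d + 1"] by (simp add: power2_sum)
    ultimately show ?thesis
      using mult_strict_right_mono_neg[of "- 2" "floquet_trace E" d] by linarith
  qed
qed

end

section \<open>High energies\<close>

lemma tendsto_inverse_sqrt_at_top: "((\<lambda>E. 1 / sqrt (2 * E)) \<longlongrightarrow> 0) at_top"
  by (intro tendsto_divide_0[OF tendsto_const] filterlim_at_top_imp_at_infinity
      filterlim_compose[OF sqrt_at_top] filterlim_tendsto_pos_mult_at_top[OF tendsto_const] filterlim_ident) auto

context synchronous_pendula
begin

text \<open>To first order in \<open>h = 1 / sqrt (2 E)\<close> the angle stays at \<open>\<theta>\<^sub>0\<close> and its rate is \<open>h (cos\<^sup>2 \<theta>\<^sub>0 + q sin\<^sup>2 \<theta>\<^sub>0)\<close>. Over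
\<open>[0, 2\<pi>]\<close> the function \<open>q\<close> has mean \<open>2\<kappa>\<close>, because \<open>V'\<close> is periodic, so the total advance is about \<open>2\<pi> h\<close> times
\<open>cos\<^sup>2 \<theta>\<^sub>0 + 2\<kappa> sin\<^sup>2 \<theta>\<^sub>0\<close>. The bounds have to be uniform in \<open>\<theta>\<^sub>0\<close>.\<close>

lemma rotation_at_high_energy:
  obtains E\<^sub>0 where "0 < E\<^sub>0"
    "\<And>E \<theta>\<^sub>0. E\<^sub>0 < E \<Longrightarrow> 0 < angle \<theta>\<^sub>0 E (2 * pi) - \<theta>\<^sub>0 \<and> angle \<theta>\<^sub>0 E (2 * pi) - \<theta>\<^sub>0 < pi"
proof -
  obtain Q where Q: "0 < Q" "\<And>x. \<bar>stiffness x\<bar> \<le> Q"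
    using stiffness_bounded by blast
  obtain B where B: "0 < B" "\<And>x. - B \<le> V x"
    using V_bounded by blast
  (* Lower bound of cos^2 + 2 kappa sin^2. *)
  define \<mu> where "\<mu> = min 1 (2 * \<kappa>)"
  have \<mu>: "0 < \<mu>" using coupling_pos by (simp add: \<mu>_def)
  define h where "h E = 1 / sqrt (2 * E)" for E :: real
  (* Error of the first order rate, divided by h: the first term is due to the motion of the
     angle, the second to the variation of the slowness. *)
  define \<eta> where "\<eta> E = (1 + Q) * (2 * pi * (h E * (1 + Q)) + B / E)" for E
  have h_lim: "(h \<longlongrightarrow> 0) at_top"
    unfolding h_def[abs_def] by (rule tendsto_inverse_sqrt_at_top)
  have "((\<lambda>E. B / E) \<longlongrightarrow> 0) at_top"
    by (intro tendsto_divide_0[OF tendsto_const] filterlim_at_top_imp_at_infinity filterlim_ident)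
  then have "(\<eta> \<longlongrightarrow> (1 + Q) * (2 * pi * (0 * (1 + Q)) + 0)) at_top"
    unfolding \<eta>_def[abs_def] by (intro tendsto_intros h_lim)
  then have "\<forall>\<^sub>F E in at_top. \<eta> E < \<mu>"
    using \<mu> by (intro order_tendstoD) auto
  moreover have "((\<lambda>E. h E * (1 + Q)) \<longlongrightarrow> 0 * (1 + Q)) at_top"
    by (intro tendsto_intros h_lim)
  then have "\<forall>\<^sub>F E in at_top. h E * (1 + Q) < 1 / 2"
    by (intro order_tendstoD) auto
  ultimately have "\<forall>\<^sub>F E in at_top. \<eta> E < \<mu> \<and> h E * (1 + Q) < 1 / 2"
    by (rule eventually_conj)
  then obtain E\<^sub>1 where E\<^sub>1: "\<And>E. E\<^sub>1 \<le> E \<Longrightarrow> \<eta> E < \<mu> \<and> h E * (1 + Q) < 1 / 2"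
    by (auto simp: eventually_at_top_linorder)
  have "0 < angle \<theta>\<^sub>0 E (2 * pi) - \<theta>\<^sub>0 \<and> angle \<theta>\<^sub>0 E (2 * pi) - \<theta>\<^sub>0 < pi" if E1: "max 1 E\<^sub>1 < E" for E \<theta>\<^sub>0
  proof -
    have E: "0 < E" and small: "\<eta> E < \<mu>" "h E * (1 + Q) < 1 / 2"
      using E1 E\<^sub>1[of E] by auto
    have h: "0 < h E" using E by (simp add: h_def)
    let ?\<theta> = "angle \<theta>\<^sub>0 E"
    let ?F = "\<lambda>x u. (cos u)\<^sup>2 + stiffness x * (sin u)\<^sup>2"
    note \<theta>' = angle_has_derivative[OF E, of \<theta>\<^sub>0]
    have F_bound: "\<bar>?F x u\<bar> \<le> 1 + Q" for x u
    proof -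
      have "\<bar>?F x u\<bar> \<le> (cos u)\<^sup>2 + \<bar>stiffness x\<bar> * (sin u)\<^sup>2"
        by (intro order_trans[OF abs_triangle_ineq]) (simp add: abs_mult)
      also have "\<dots> \<le> 1 + Q * 1"
        using Q(1) Q(2)[of x] by (intro add_mono mult_mono) (auto simp: abs_square_le_1)
      finally show ?thesis by simp
    qed
    have F_lip: "\<bar>?F x u - ?F x v\<bar> \<le> (1 + Q) * \<bar>u - v\<bar>" for x u v
    proof -
      have "?F x u - ?F x v = (1 - stiffness x) / 2 * (cos (2 * u) - cos (2 * v))"
        unfolding cos2_plus_mult_sin2 right_diff_distrib by simp
      then have "\<bar>?F x u - ?F x v\<bar> = \<bar>1 - stiffness x\<bar> / 2 * \<bar>cos (2 * u) - cos (2 * v)\<bar>"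
        by (simp only: abs_mult abs_divide abs_numeral)
      also have "\<dots> \<le> (1 + Q) / 2 * \<bar>2 * u - 2 * v\<bar>"
        using Q(2)[of x] Q(1) by (intro mult_mono abs_cos_diff_le divide_right_mono) auto
      also have "\<dots> = (1 + Q) * \<bar>u - v\<bar>"
        by (simp add: abs_if)
      finally show ?thesis .
    qed
    have rate_abs: "\<bar>slowness E x * ?F x u\<bar> \<le> h E * (1 + Q)" for x u
    proof -
      have "\<bar>slowness E x * ?F x u\<bar> = slowness E x * \<bar>?F x u\<bar>"
        using slowness_pos[OF E, of x] by (simp add: abs_mult)
      also have "\<dots> \<le> h E * (1 + Q)"
        using h slowness_le[OF E, of x] by (intro mult_mono F_bound) (auto simp: h_def)
      finally show ?thesis .
    qed
    have lin: "((\<lambda>x. c * x) has_real_derivative c) (at x)" for c x :: real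
      by (auto intro!: derivative_eq_intros)
    have upper: "?\<theta> x - \<theta>\<^sub>0 \<le> h E * (1 + Q) * x" if "0 \<le> x" for x
      using nondecreasing_difference[OF that lin \<theta>'] rate_abs angle_0[OF E] by (simp add: abs_le_iff)
    have lower: "- (h E * (1 + Q)) * x \<le> ?\<theta> x - \<theta>\<^sub>0" if "0 \<le> x" for x
      using nondecreasing_difference[OF that \<theta>' lin, of "- (h E * (1 + Q))"] rate_abs angle_0[OF E]
      by (simp add: abs_le_iff minus_le_iff)
    have near: "\<bar>?\<theta> x - \<theta>\<^sub>0\<bar> \<le> 2 * pi * (h E * (1 + Q))" if x: "0 \<le> x" "x \<le> 2 * pi" for x
    proof -
      have "h E * (1 + Q) * x \<le> h E * (1 + Q) * (2 * pi)"
        using h Q(1) x by (intro mult_left_mono) auto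
      then show ?thesis
        using upper[OF x(1)] lower[OF x(1)] by (simp add: abs_le_iff algebra_simps)
    qed
    (* Antiderivative of the rate, divided by h, with the angle frozen at its initial value. *)
    let ?G = "\<lambda>x. x * (cos \<theta>\<^sub>0)\<^sup>2 + (2 * \<kappa> * x + deriv V x) * (sin \<theta>\<^sub>0)\<^sup>2"
    have G': "((\<lambda>x. h E * ?G x - h E * \<eta> E * x) has_real_derivative h E * ?F x \<theta>\<^sub>0 - h E * \<eta> E) (at x)" for x
      by (auto intro!: derivative_eq_intros V'_has_derivative simp: stiffness_def)
    have rate_ge: "h E * ?F x \<theta>\<^sub>0 - h E * \<eta> E \<le> slowness E x * ?F x (?\<theta> x)" if x: "0 \<le> x" "x \<le> 2 * pi" for x
    proof -
      have "(1 + Q) * \<bar>?\<theta> x - \<theta>\<^sub>0\<bar> \<le> (1 + Q) * (2 * pi * (h E * (1 + Q)))"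
        using Q(1) by (intro mult_left_mono near x) simp
      then have "?F x \<theta>\<^sub>0 - (1 + Q) * (2 * pi * (h E * (1 + Q))) \<le> ?F x (?\<theta> x)"
        using F_lip[where x = x and u = "?\<theta> x" and v = \<theta>\<^sub>0] by linarith
      then have 1: "h E * (?F x \<theta>\<^sub>0 - (1 + Q) * (2 * pi * (h E * (1 + Q)))) \<le> h E * ?F x (?\<theta> x)"
        using h by (intro mult_left_mono) auto
      have "0 \<le> h E - slowness E x" "h E - slowness E x \<le> h E * (B / E)"
        using slowness_le[OF E, of x] slowness_ge[OF E B(2), of x]
        unfolding h_def[symmetric] right_diff_distrib by linarith+
      then have "(h E - slowness E x) * ?F x (?\<theta> x) \<le> h E * (B / E) * (1 + Q)"
        using F_bound[of "?\<theta> x" x] h E B(1) Q(1)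
        by (intro order_trans[OF mult_left_mono mult_right_mono]) (auto simp: abs_le_iff)
      with 1 show ?thesis
        by (simp add: \<eta>_def algebra_simps)
    qed
    have "(h E * ?G (2 * pi) - h E * \<eta> E * (2 * pi)) - (h E * ?G 0 - h E * \<eta> E * 0) \<le> ?\<theta> (2 * pi) - ?\<theta> 0"
      by (rule nondecreasing_difference[OF _ \<theta>' G' rate_ge]) auto
    then have "h E * (2 * pi * (cos \<theta>\<^sub>0)\<^sup>2 + 4 * pi * \<kappa> * (sin \<theta>\<^sub>0)\<^sup>2) - h E * \<eta> E * (2 * pi) \<le> ?\<theta> (2 * pi) - \<theta>\<^sub>0"
      using angle_0[OF E] V'_periodic[of 0] by (simp add: algebra_simps)
    moreover have "h E * (2 * pi * (cos \<theta>\<^sub>0)\<^sup>2 + 4 * pi * \<kappa> * (sin \<theta>\<^sub>0)\<^sup>2) - h E * \<eta> E * (2 * pi)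
        = 2 * pi * h E * (((cos \<theta>\<^sub>0)\<^sup>2 + 2 * \<kappa> * (sin \<theta>\<^sub>0)\<^sup>2) - \<eta> E)"
      by (simp add: algebra_simps)
    moreover have "0 < 2 * pi * h E * (((cos \<theta>\<^sub>0)\<^sup>2 + 2 * \<kappa> * (sin \<theta>\<^sub>0)\<^sup>2) - \<eta> E)"
      using h small(1) cos2_plus_mult_sin2_ge[of \<mu> "2 * \<kappa>" \<theta>\<^sub>0] by (intro mult_pos_pos) (auto simp: \<mu>_def)
    moreover have "?\<theta> (2 * pi) - \<theta>\<^sub>0 < pi"
    proof -
      have "h E * (1 + Q) * (2 * pi) < 1 / 2 * (2 * pi)"
        by (intro mult_strict_right_mono small) simp
      also have "1 / 2 * (2 * pi) = pi" by simp
      finally show ?thesis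
        using pi_gt_zero by (intro le_less_trans[OF upper]) auto
    qed
    ultimately show ?thesis by linarith
  qed
  then show thesis
    by (intro that[of "max 1 E\<^sub>1"]) auto
qed

end

section \<open>Energies near zero\<close>

context synchronous_pendula
begin

text \<open>Away from \<open>\<pi>\<close> the slowness is bounded uniformly in \<open>E\<close>, so the angle can only lose a bounded amount there.
Near \<open>\<pi>\<close> the stiffness is positive and the angle increases; to the right of \<open>\<pi>\<close> the quadratic bound
\<open>V x \<ge> - L (x - \<pi>)\<^sup>2\<close> makes its rate at least a constant times \<open>1 / (sqrt E + sqrt L (x - \<pi>))\<close>, whose integral
is of order \<open>ln (1 / E)\<close>.\<close>

lemma angle_unbounded_near_zero_energy:
  assumes "0 < \<epsilon>"
  obtains E where "0 < E" "E < \<epsilon>" "R \<le> angle 0 E (2 * pi)"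
proof -
  obtain Q where Q: "0 < Q" "\<And>x. \<bar>stiffness x\<bar> \<le> Q"
    using stiffness_bounded by blast
  obtain L where L: "0 < L" "\<And>x. \<bar>deriv (deriv V) x\<bar> \<le> L"
    using V''_bounded by blast
  have "0 < stiffness pi / 2"
    using coupling by (simp add: stiffness_def)
  moreover have "isCont stiffness pi"
    using stiffness_continuous[of UNIV] by (simp add: continuous_on_eq_continuous_at)
  ultimately obtain \<delta>' where \<delta>': "0 < \<delta>'" "\<And>x. \<bar>x - pi\<bar> < \<delta>' \<Longrightarrow> \<bar>stiffness x - stiffness pi\<bar> < stiffness pi / 2"
    unfolding continuous_at_eps_delta dist_real_def by metis
  (* The bound 1 keeps the neighbourhood of pi inside the period interval. *)
  define \<delta> where "\<delta> = min 1 (\<delta>' / 2)"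
  have \<delta>: "0 < \<delta>" "\<delta> < pi" "\<delta> < \<delta>'"
    using \<delta>'(1) pi_gt3 by (auto simp: \<delta>_def)
  define m where "m = min 1 (stiffness pi / 2)"
  have m: "0 < m"
    using \<open>0 < stiffness pi / 2\<close> by (simp add: m_def)
  have F_near: "m \<le> (cos u)\<^sup>2 + stiffness x * (sin u)\<^sup>2" if "\<bar>x - pi\<bar> \<le> \<delta>" for x u
  proof (rule cos2_plus_mult_sin2_ge)
    have "\<bar>stiffness x - stiffness pi\<bar> < stiffness pi / 2"
      using \<delta>(3) that by (intro \<delta>'(2)) simp
    then show "m \<le> stiffness x"
      unfolding abs_less_iff m_def min_le_iff_disj by simp
  qed (simp add: m_def)
  have F_ge: "- Q \<le> (cos u)\<^sup>2 + stiffness x * (sin u)\<^sup>2" for x u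
    using Q(1) Q(2)[of x] by (intro cos2_plus_mult_sin2_ge) auto
  obtain c where c: "0 < c" "\<And>x. x \<in> {0..pi - \<delta>} \<union> {pi + \<delta>..2 * pi} \<Longrightarrow> V x \<le> - c"
  proof -
    let ?K = "{0..pi - \<delta>} \<union> {pi + \<delta>..2 * pi}"
    have "compact ?K" "?K \<noteq> {}" using \<delta> by (auto intro: compact_Un)
    then obtain z where z: "z \<in> ?K" "\<And>x. x \<in> ?K \<Longrightarrow> V x \<le> V z"
      using continuous_attains_sup[OF _ _ V_continuous] by metis
    have "V z < 0"
    proof (rule V_neg, intro allI notI)
      fix k :: int assume zk: "z = pi + 2 * pi * of_int k"
      have "0 \<le> z" "z \<le> 2 * pi" "z \<noteq> pi" using z(1) \<delta> by auto
      moreover have "2 * pi * 1 \<le> 2 * pi * of_int k" if "1 \<le> k"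
        using that by (intro mult_left_mono) auto
      moreover have "2 * pi * of_int k \<le> 2 * pi * (- 1)" if "k \<le> - 1"
        using that by (intro mult_left_mono) auto
      moreover have "k = 0 \<or> 1 \<le> k \<or> k \<le> - 1" by linarith
      ultimately show False
        using zk pi_gt_zero by (elim disjE) auto
    qed
    then show thesis using that[of "- V z"] z(2) by simp
  qed
  (* The angle decreases at most at the rate C outside the neighbourhood of pi. *)
  define C where "C = Q / sqrt (2 * c)"
  have C: "0 < C" using Q(1) c(1) by (simp add: C_def)
  define l where "l = sqrt L"
  have l: "0 < l" "L = l\<^sup>2" using L(1) by (simp_all add: l_def)
  define k where "k = m / (sqrt 2 * l)"
  have k: "0 < k" using m l by (simp add: k_def)
  have V_ge: "- (L * (x - pi)\<^sup>2) \<le> V x" if "pi \<le> x" for x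
  proof -
    have V'_pi: "deriv V pi = 0"
      by (rule DERIV_local_max[OF V_has_derivative, of 1]) (simp_all add: V_pi V_nonpos)
    have V'_diff: "- (2 * L * y) - - (2 * L * pi) \<le> deriv V y - deriv V pi" if "pi \<le> y" for y
    proof (rule nondecreasing_difference[OF that])
      show "((\<lambda>y. - (2 * L * y)) has_real_derivative - (2 * L)) (at z)" for z
        by (auto intro!: derivative_eq_intros)
      show "- (2 * L) \<le> deriv (deriv V) z" for z
        using L(1) L(2)[of z] by linarith
    qed (rule V'_has_derivative)
    have V': "- (2 * L * (y - pi)) \<le> deriv V y" if "pi \<le> y" for y
      using V'_diff[OF that] V'_pi by (simp add: algebra_simps)
    have "- (L * (x - pi)\<^sup>2) - - (L * (pi - pi)\<^sup>2) \<le> V x - V pi"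
    proof (rule nondecreasing_difference[OF that])
      show "((\<lambda>y. - (L * (y - pi)\<^sup>2)) has_real_derivative - (2 * L * (z - pi))) (at z)" for z
        by (auto intro!: derivative_eq_intros)
    qed (use V' in \<open>auto intro: V_has_derivative\<close>)
    then show ?thesis by (simp add: V_pi)
  qed
  (* With E = e^2 the energy combines with the quadratic bound into the square of e + l (x - pi). *)
  have angle_ge: "- (2 * pi * C) + k * (ln (l * \<delta>) - ln e) \<le> angle 0 (e\<^sup>2) (2 * pi)" if e: "0 < e" for e
  proof -
    define E where "E = e\<^sup>2"
    have E: "0 < E" using e by (simp add: E_def)
    let ?\<theta> = "angle 0 E"
    let ?F = "\<lambda>x. (cos (?\<theta> x))\<^sup>2 + stiffness x * (sin (?\<theta> x))\<^sup>2"
    note \<theta>' = angle_has_derivative[OF E, of 0]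
    have far: "- C \<le> slowness E x * ?F x" if "V x \<le> - c" for x
    proof -
      have "slowness E x \<le> 1 / sqrt (2 * c)"
        unfolding slowness_def using that E c(1)
        by (intro divide_left_mono mult_pos_pos real_sqrt_le_mono) auto
      then have "slowness E x * Q \<le> C"
        using Q(1) mult_right_mono[of "slowness E x" "1 / sqrt (2 * c)" Q] by (simp add: C_def)
      moreover have "slowness E x * - Q \<le> slowness E x * ?F x"
        using slowness_pos[OF E, of x] F_ge by (intro mult_left_mono) auto
      ultimately show ?thesis by simp
    qed
    have lin: "((\<lambda>x. - C * x) has_real_derivative - C) (at x)" for x
      by (auto intro!: derivative_eq_intros)
    (* The four parts of the period: approach, left half of the neighbourhood, where only the sign
       counts, right half, where the logarithm is gained, and departure. *)
    have 1: "- C * (pi - \<delta>) - - C * 0 \<le> ?\<theta> (pi - \<delta>) - ?\<theta> 0"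
      by (rule nondecreasing_difference[OF _ \<theta>' lin]) (use \<delta> c(2) far in auto)
    have 2: "0 - 0 \<le> ?\<theta> pi - ?\<theta> (pi - \<delta>)"
    proof (rule nondecreasing_difference[OF _ \<theta>' DERIV_const])
      fix x assume "pi - \<delta> \<le> x" "x \<le> pi"
      then have "m \<le> ?F x" by (intro F_near) auto
      then show "0 \<le> slowness E x * ?F x"
        using slowness_pos[OF E, of x] m by (intro mult_nonneg_nonneg) auto
    qed (use \<delta> in auto)
    have 3: "k * ln (e + l * (pi + \<delta> - pi)) - k * ln (e + l * (pi - pi)) \<le> ?\<theta> (pi + \<delta>) - ?\<theta> pi"
    proof (rule nondecreasing_difference[OF _ \<theta>'])
      fix x assume x: "pi \<le> x" "x \<le> pi + \<delta>"
      then have pos: "0 < e + l * (x - pi)"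
        using e l by (intro add_pos_nonneg) auto
      then show "((\<lambda>x. k * ln (e + l * (x - pi))) has_real_derivative m * (1 / (sqrt 2 * (e + l * (x - pi))))) (at x)"
      proof -
        have "k * (l / y) = m * (1 / (sqrt 2 * y))" if "0 < y" for y
          using that l by (simp add: k_def)
        note eq = this[OF pos]
        have "((\<lambda>x. k * ln (e + l * (x - pi))) has_real_derivative k * (l / (e + l * (x - pi)))) (at x)"
          using pos by (auto intro!: derivative_eq_intros)
        then show ?thesis unfolding eq .
      qed
      have "E - V x \<le> e\<^sup>2 + (l * (x - pi))\<^sup>2"
        using V_ge[OF x(1)] by (simp add: E_def l(2) power_mult_distrib)
      also have "\<dots> \<le> (e + l * (x - pi))\<^sup>2"
        using e l x by (simp add: power2_sum)
      finally have "sqrt (2 * (E - V x)) \<le> sqrt (2 * (e + l * (x - pi))\<^sup>2)"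
        by (intro real_sqrt_le_mono) simp
      also have "\<dots> = sqrt 2 * (e + l * (x - pi))"
        using pos by (simp add: real_sqrt_mult)
      finally have "1 / (sqrt 2 * (e + l * (x - pi))) \<le> slowness E x"
        unfolding slowness_def using pos kinetic_pos[OF E, of x]
        by (intro divide_left_mono mult_pos_pos) auto
      then have "1 / (sqrt 2 * (e + l * (x - pi))) * m \<le> slowness E x * ?F x"
        using F_near[of x] x m slowness_pos[OF E, of x] by (intro mult_mono) auto
      then show "m * (1 / (sqrt 2 * (e + l * (x - pi)))) \<le> slowness E x * ?F x"
        by (simp add: mult.commute)
    qed (use \<delta> in auto)
    have 4: "- C * (2 * pi) - - C * (pi + \<delta>) \<le> ?\<theta> (2 * pi) - ?\<theta> (pi + \<delta>)"
      by (rule nondecreasing_difference[OF _ \<theta>' lin]) (use \<delta> c(2) far in auto)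
    have "ln (l * \<delta>) \<le> ln (e + l * \<delta>)"
      using e mult_pos_pos[OF l(1) \<delta>(1)] by (subst ln_le_cancel_iff) linarith+
    then have "k * (ln (l * \<delta>) - ln e) \<le> k * ln (e + l * (pi + \<delta> - pi)) - k * ln (e + l * (pi - pi))"
      using k by (simp add: right_diff_distrib[symmetric])
    moreover have "0 \<le> C * \<delta>" using C \<delta> by simp
    ultimately show ?thesis
      using 1 2 3 4 angle_0[OF E, of 0] unfolding E_def[symmetric] by (simp add: algebra_simps)
  qed
  (* The first entry solves - 2 pi C + k (ln (l delta) - ln e) = R; the second one makes e^2 less
     than epsilon. *)
  define e where "e = min (l * \<delta> * exp (- ((R + 2 * pi * C) / k))) (sqrt \<epsilon> / 2)"
  have e: "0 < e" using l \<delta> assms by (simp add: e_def)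
  have "ln e \<le> ln (l * \<delta> * exp (- ((R + 2 * pi * C) / k)))"
    using e by (subst ln_le_cancel_iff) (auto simp: e_def l \<delta>)
  also have "\<dots> = ln (l * \<delta>) - (R + 2 * pi * C) / k"
    using l \<delta> by (simp add: ln_mult)
  finally have "(R + 2 * pi * C) / k \<le> ln (l * \<delta>) - ln e" by simp
  then have "R + 2 * pi * C \<le> k * (ln (l * \<delta>) - ln e)"
    using k by (simp add: pos_divide_le_eq mult.commute)
  then have "R \<le> angle 0 (e\<^sup>2) (2 * pi)"
    using angle_ge[OF e] by linarith
  moreover have "e\<^sup>2 < \<epsilon>"
  proof -
    have "e\<^sup>2 \<le> (sqrt \<epsilon> / 2)\<^sup>2"
      using e by (intro power_mono) (auto simp: e_def)
    also have "\<dots> < \<epsilon>" using assms by (simp add: power_divide)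
    finally show ?thesis .
  qed
  ultimately show thesis
    using that[of "e\<^sup>2"] e by simp
qed

text \<open>The final angle is continuous in \<open>E\<close>, finite at \<open>\<epsilon> / 2\<close> and arbitrarily large further below, so every
sufficiently large value is attained.\<close>

lemma half_turns_near_zero_energy:
  assumes "0 < \<epsilon>"
  obtains n E E' where "0 < E" "E < \<epsilon>" "angle 0 E (2 * pi) = real n * pi"
    "0 < E'" "E' < \<epsilon>" "angle 0 E' (2 * pi) = real (Suc n) * pi"
proof -
  let ?\<phi> = "\<lambda>E. angle 0 E (2 * pi)"
  obtain n where n: "?\<phi> (\<epsilon> / 2) / pi \<le> real n"
    using real_arch_simple by blast
  then have n: "?\<phi> (\<epsilon> / 2) \<le> real n * pi"
    by (simp add: pos_divide_le_eq)
  obtain E\<^sub>1 where E\<^sub>1: "0 < E\<^sub>1" "E\<^sub>1 < \<epsilon> / 2" "real (Suc n) * pi \<le> ?\<phi> E\<^sub>1"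
    using angle_unbounded_near_zero_energy[of "\<epsilon> / 2"] assms by auto
  have cont: "continuous_on {E\<^sub>1..\<epsilon> / 2} ?\<phi>"
    using E\<^sub>1 by (intro continuous_on_subset[OF angle_continuous]) auto
  have hit: "\<exists>E. 0 < E \<and> E < \<epsilon> \<and> ?\<phi> E = y" if "?\<phi> (\<epsilon> / 2) \<le> y" "y \<le> ?\<phi> E\<^sub>1" for y
  proof -
    from IVT2'[of ?\<phi>, OF that less_imp_le[OF E\<^sub>1(2)] cont]
    obtain E where "E\<^sub>1 \<le> E" "E \<le> \<epsilon> / 2" "?\<phi> E = y" by blast
    then show ?thesis using E\<^sub>1 assms by (intro exI[of _ E]) auto
  qed
  have le: "real n * pi \<le> real (Suc n) * pi" by (simp add: algebra_simps)
  obtain E where "0 < E" "E < \<epsilon>" "?\<phi> E = real n * pi"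
    using hit[OF n] le E\<^sub>1(3) by fastforce
  moreover obtain E' where "0 < E'" "E' < \<epsilon>" "?\<phi> E' = real (Suc n) * pi"
    using hit[OF order_trans[OF n le] E\<^sub>1(3)] by blast
  ultimately show thesis by (rule that)
qed

lemma trace_extremes_near_zero_energy:
  assumes "0 < \<epsilon>"
  obtains E E' where "0 < E" "E < \<epsilon>" "2 \<le> floquet_trace E" "0 < E'" "E' < \<epsilon>" "floquet_trace E' \<le> - 2"
proof -
  obtain n E E' where *: "0 < E" "E < \<epsilon>" "angle 0 E (2 * pi) = real n * pi"
    "0 < E'" "E' < \<epsilon>" "angle 0 E' (2 * pi) = real (Suc n) * pi"
    using half_turns_near_zero_energy[OF assms] .
  show thesis
  proof (cases "even n")
    case True
    then show thesis
      using that[of E E'] * trace_at_half_turn(1)[OF *(1,3)] trace_at_half_turn(2)[OF *(4,6)] by simp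
  next
    case False
    then show thesis
      using that[of E' E] * trace_at_half_turn(2)[OF *(1,3)] trace_at_half_turn(1)[OF *(4,6)] by simp
  qed
qed

lemma trace_vanishes_near_zero_energy:
  assumes "0 < \<epsilon>"
  obtains E where "0 < E" "E < \<epsilon>" "floquet_trace E = 0"
proof -
  obtain E E' where *: "0 < E" "E < \<epsilon>" "2 \<le> floquet_trace E" "0 < E'" "E' < \<epsilon>" "floquet_trace E' \<le> - 2"
    using trace_extremes_near_zero_energy[OF assms] .
  have "connected (floquet_trace ` {0<..<\<epsilon>})"
    by (intro connected_continuous_image continuous_on_subset[OF floquet_trace_continuous]) auto
  then have "0 \<in> floquet_trace ` {0<..<\<epsilon>}"
  proof (rule connectedD_interval)
    show "floquet_trace E' \<in> floquet_trace ` {0<..<\<epsilon>}" "floquet_trace E \<in> floquet_trace ` {0<..<\<epsilon>}"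
      using * by (intro imageI; simp)+
  qed (use * in linarith)+
  then obtain e where "0 = floquet_trace e" "e \<in> {0<..<\<epsilon>}"
    by (rule imageE)
  then show thesis by (intro that[of e]) auto
qed

end

section \<open>Alternation of stable and unstable energies\<close>

text \<open>The gaps between consecutive segments are chosen one below the other: beneath the last gap there is a
point outside \<open>S\<close>, beneath that point there is a point of \<open>S\<close>, and a small interval around the latter is
the next gap. What lies between two gaps becomes a segment.\<close>

lemma alternating_energy_sequence:
  fixes S :: "real set"
  assumes stable_open: "open S" and top: "0 < E\<^sub>0" "{E\<^sub>0<..} \<subseteq> S"
    and stable: "\<And>\<epsilon>. 0 < \<epsilon> \<Longrightarrow> \<exists>s\<in>S. 0 < s \<and> s < \<epsilon>"
    and unstable: "\<And>\<epsilon>. 0 < \<epsilon> \<Longrightarrow> \<exists>u. u \<notin> S \<and> 0 < u \<and> u < \<epsilon>"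
  shows "\<exists>E :: nat \<Rightarrow> real.
    (\<forall>n\<ge>1. 0 < E n) \<and>
    (\<forall>n\<ge>1. E (2 * n) \<le> E (2 * n - 1) \<and> E (2 * n + 1) < E (2 * n)) \<and>
    E \<longlonglongrightarrow> 0 \<and>
    (\<forall>n\<ge>1. \<exists>e\<in>{E (2 * n)..E (2 * n - 1)}. e \<notin> S) \<and>
    (\<forall>n\<ge>1. {E (2 * n + 1)<..<E (2 * n)} \<subseteq> S) \<and> {E 1<..} \<subseteq> S"
proof -
  (* A gap is stored as the pair of its lower and upper end; "below n g g'" says that g' may follow g
     as gap number n + 1. *)
  define gap where "gap g \<longleftrightarrow> 0 < fst g \<and> fst g < snd g \<and> {fst g<..<snd g} \<subseteq> S" for g :: "real \<times> real"
  define below where "below n g g' \<longleftrightarrow> snd g' \<le> fst g \<and> snd g' < 1 / real (Suc n) \<and> (\<exists>u. u \<notin> S \<and> snd g' \<le> u \<and> u \<le> fst g)"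
    for n and g g' :: "real \<times> real"
  have step: "\<exists>g'. gap g' \<and> below n g g'" if "gap g" for n g
  proof -
    have "0 < min (fst g) (1 / real (Suc n))" using that by (simp add: gap_def)
    then obtain u where u: "u \<notin> S" "0 < u" "u < min (fst g) (1 / real (Suc n))"
      using unstable by blast
    obtain s where s: "s \<in> S" "0 < s" "s < u" using stable[OF u(2)] by blast
    obtain r where r: "0 < r" "ball s r \<subseteq> S"
      using stable_open s(1) open_contains_ball by blast
    define d where "d = min r (min (s / 2) (u - s))"
    have d: "0 < d" using r(1) s by (simp add: d_def)
    have "d \<le> r" and le: "d \<le> min (s / 2) (u - s)" by (simp_all only: d_def min.cobounded1 min.cobounded2)
    with d have d: "0 < d" "d \<le> r" "d \<le> s / 2" "d \<le> u - s"
      unfolding min.bounded_iff by blast+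
    have "{s - d<..<s + d} \<subseteq> ball s r" using d by (auto simp: dist_real_def)
    then have "gap (s - d, s + d)"
      using r(2) d s by (auto simp: gap_def)
    moreover have "below n g (s - d, s + d)"
      unfolding below_def using u d by (auto intro!: exI[of _ u])
    ultimately show ?thesis by blast
  qed
  (* A fictitious gap number 0 above all segments; only its lower end, the first energy of the
     sequence, is used. *)
  have "gap (E\<^sub>0, E\<^sub>0 + 1)" using top by (auto simp: gap_def)
  then obtain g where "\<forall>n. (gap (g n) \<and> (n = 0 \<longrightarrow> g n = (E\<^sub>0, E\<^sub>0 + 1))) \<and> below n (g n) (g (Suc n))"
    using dependent_nat_choice[of "\<lambda>n x. gap x \<and> (n = 0 \<longrightarrow> x = (E\<^sub>0, E\<^sub>0 + 1))" below] step by auto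
  then have g: "g 0 = (E\<^sub>0, E\<^sub>0 + 1)" "\<And>n. gap (g n)" "\<And>n. below n (g n) (g (Suc n))"
    by blast+
  define E where "E n = (if even n then snd (g (n div 2)) else fst (g (n div 2)))" for n
  have even: "E (2 * n) = snd (g n)" and odd: "E (2 * n + 1) = fst (g n)" for n
    by (simp_all add: E_def)
  have odd': "E (2 * n - 1) = fst (g (n - 1))" if "1 \<le> n" for n
  proof -
    have "2 * n - 1 = 2 * (n - 1) + 1" using that by linarith
    then show ?thesis by (simp only: odd)
  qed
  have pos: "0 < E n" for n
    using g(2)[of "n div 2"] by (auto simp: E_def gap_def)
  have small: "E n < 1 / real N" if "1 \<le> N" "2 * N \<le> n" for n N
  proof -
    have N_le: "N \<le> n div 2" using that by linarith
    with that(1) have "n div 2 \<noteq> 0" by linarith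
    then obtain k where k: "n div 2 = Suc k"
      using not0_implies_Suc by blast
    have "E n \<le> snd (g (Suc k))"
      using g(2)[of "Suc k"] by (auto simp: E_def k gap_def)
    also have "\<dots> < 1 / real (Suc k)"
      using g(3)[of k] by (simp add: below_def)
    also have "\<dots> \<le> 1 / real N"
      using that(1) N_le k by (intro divide_left_mono) auto
    finally show ?thesis .
  qed
  have lim: "E \<longlonglongrightarrow> 0"
  proof (rule LIMSEQ_I)
    fix \<epsilon> :: real assume "0 < \<epsilon>"
    then obtain N where N: "N \<noteq> 0" "inverse (real N) < \<epsilon>"
      using real_arch_inverse by blast
    have "norm (E n - 0) < \<epsilon>" if "2 * N \<le> n" for n
      using small[OF _ that] N pos[of n] by (simp add: inverse_eq_divide)
    then show "\<exists>no. \<forall>n\<ge>no. norm (E n - 0) < \<epsilon>" by blast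
  qed
  have below_g: "below (n - 1) (g (n - 1)) (g n)" if "1 \<le> n" for n
    using g(3)[of "n - 1"] that by simp
  have segment: "E (2 * n) \<le> E (2 * n - 1)" "\<exists>e\<in>{E (2 * n)..E (2 * n - 1)}. e \<notin> S" if "1 \<le> n" for n
    using below_g[OF that] unfolding odd'[OF that] even by (auto simp: below_def)
  have gap_E: "E (2 * n + 1) < E (2 * n)" "{E (2 * n + 1)<..<E (2 * n)} \<subseteq> S" for n
    using g(2)[of n] unfolding even odd by (simp_all add: gap_def)
  have "{E 1<..} \<subseteq> S"
    using odd[of 0] g(1) top by simp
  with pos lim segment gap_E show ?thesis
    by (intro exI[of _ E] conjI allI impI)
qed

context synchronous_pendula
begin

lemma stability_alternates:
  "\<exists>E :: nat \<Rightarrow> real.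
     (\<forall>n\<ge>1. 0 < E n) \<and>
     (\<forall>n\<ge>1. E (2 * n) \<le> E (2 * n - 1) \<and> E (2 * n + 1) < E (2 * n)) \<and>
     E \<longlonglongrightarrow> 0 \<and>
     (\<forall>n\<ge>1. \<exists>e\<in>{E (2 * n)..E (2 * n - 1)}. \<not> strongly_stable V \<kappa> e) \<and>
     (\<forall>n\<ge>1. \<forall>e\<in>{E (2 * n + 1)<..<E (2 * n)}. strongly_stable V \<kappa> e) \<and>
     (\<forall>e>E 1. strongly_stable V \<kappa> e)"
proof -
  define S where "S = {0<..} \<inter> floquet_trace -` {-2<..<2}"
  have S_iff: "E \<in> S \<longleftrightarrow> 0 < E \<and> strongly_stable V \<kappa> E" for E
    using strongly_stable_iff[of E] by (auto simp: S_def abs_less_iff)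
  have "open S"
    unfolding S_def by (intro continuous_open_preimage floquet_trace_continuous) auto
  moreover obtain E\<^sub>0 where E\<^sub>0: "0 < E\<^sub>0"
    "\<And>E \<theta>\<^sub>0. E\<^sub>0 < E \<Longrightarrow> 0 < angle \<theta>\<^sub>0 E (2 * pi) - \<theta>\<^sub>0 \<and> angle \<theta>\<^sub>0 E (2 * pi) - \<theta>\<^sub>0 < pi"
    using rotation_at_high_energy by blast
  moreover have "{E\<^sub>0<..} \<subseteq> S"
  proof
    fix E assume "E \<in> {E\<^sub>0<..}"
    then have E: "0 < E" "E\<^sub>0 < E" using E\<^sub>0(1) by auto
    then show "E \<in> S"
      using elliptic_if_every_direction_rotates[OF E(1) E\<^sub>0(2)[OF E(2)]]
      by (simp add: S_iff strongly_stable_iff)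
  qed
  moreover have "\<exists>s\<in>S. 0 < s \<and> s < \<epsilon>" if \<epsilon>: "0 < \<epsilon>" for \<epsilon>
  proof -
    obtain s where "0 < s" "s < \<epsilon>" "floquet_trace s = 0"
      using trace_vanishes_near_zero_energy[OF \<epsilon>] .
    then show ?thesis by (intro bexI[of _ s]) (auto simp: S_def)
  qed
  moreover have "\<exists>u. u \<notin> S \<and> 0 < u \<and> u < \<epsilon>" if \<epsilon>: "0 < \<epsilon>" for \<epsilon>
  proof -
    obtain u where "0 < u" "u < \<epsilon>" "2 \<le> floquet_trace u"
      using trace_extremes_near_zero_energy[OF \<epsilon>] by metis
    then show ?thesis by (intro exI[of _ u]) (auto simp: S_def)
  qed
  ultimately obtain E :: "nat \<Rightarrow> real" where
    pos: "\<forall>n\<ge>1. 0 < E n" and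
    order: "\<forall>n\<ge>1. E (2 * n) \<le> E (2 * n - 1) \<and> E (2 * n + 1) < E (2 * n)" and
    lim: "E \<longlonglongrightarrow> 0" and
    unstable: "\<forall>n\<ge>1. \<exists>e\<in>{E (2 * n)..E (2 * n - 1)}. e \<notin> S" and
    gaps: "\<forall>n\<ge>1. {E (2 * n + 1)<..<E (2 * n)} \<subseteq> S" and top: "{E 1<..} \<subseteq> S"
    using alternating_energy_sequence[of S E\<^sub>0] by blast
  have "\<exists>e\<in>{E (2 * n)..E (2 * n - 1)}. \<not> strongly_stable V \<kappa> e" if n: "1 \<le> n" for n
  proof -
    obtain e where e: "e \<in> {E (2 * n)..E (2 * n - 1)}" "e \<notin> S"
      using unstable n by blast
    have "0 < E (2 * n)" using pos n by simp
    with e have "0 < e" by simp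
    with e show ?thesis by (auto simp: S_iff)
  qed
  with pos order lim gaps top show ?thesis
    by (intro exI[of _ E] conjI) (auto simp: S_iff subset_iff)
qed

end

theorem theorem1:
  fixes V :: "real \<Rightarrow> real" and \<kappa> :: real
  assumes "C2_function V"
    and "\<And>x. V (x + 2 * pi) = V x"
    and "\<And>x (k::int). V x \<le> V (pi + 2 * pi * of_int k)"
    and "V pi = 0"
    and "deriv (deriv V) pi < 0"
    and "\<And>x. (\<forall>k::int. x \<noteq> pi + 2 * pi * of_int k) \<Longrightarrow> V x < 0"
    and "2 * \<kappa> > - deriv (deriv V) pi"
  shows "(\<forall>e > 0. is_running_solution V e (running_solution V e) \<and>
            solves_coupled V \<kappa> (running_solution V e) (running_solution V e)) \<and>
    (\<exists>E :: nat \<Rightarrow> real.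
       (\<forall>n \<ge> 1. 0 < E n) \<and>
       (\<forall>n \<ge> 1. E (2 * n) \<le> E (2 * n - 1) \<and> E (2 * n + 1) < E (2 * n)) \<and>
       E \<longlonglongrightarrow> 0 \<and>
       (\<forall>n \<ge> 1. \<exists>e \<in> {E (2 * n)..E (2 * n - 1)}.
          \<not> strongly_stable V \<kappa> e \<and>
          (\<exists>r :: real. r \<noteq> 0 \<and>
             transverse_eigenvalues V \<kappa> e = {complex_of_real r, complex_of_real (inverse r)})) \<and>
       (\<forall>n \<ge> 1. \<forall>e \<in> {E (2 * n + 1)<..<E (2 * n)}. strongly_stable V \<kappa> e) \<and>
       (\<forall>e > E 1. strongly_stable V \<kappa> e))"
proof -
  interpret synchronous_pendula V \<kappa>
  proof
    show "V x \<le> 0" for x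
      using assms(3)[of x 0] assms(4) by simp
  qed (use assms in auto)
  obtain E :: "nat \<Rightarrow> real" where E:
    "\<forall>n\<ge>1. 0 < E n"
    "\<forall>n\<ge>1. E (2 * n) \<le> E (2 * n - 1) \<and> E (2 * n + 1) < E (2 * n)"
    "E \<longlonglongrightarrow> 0"
    "\<forall>n\<ge>1. \<exists>e\<in>{E (2 * n)..E (2 * n - 1)}. \<not> strongly_stable V \<kappa> e"
    "\<forall>n\<ge>1. \<forall>e\<in>{E (2 * n + 1)<..<E (2 * n)}. strongly_stable V \<kappa> e"
    "\<forall>e>E 1. strongly_stable V \<kappa> e"
    using stability_alternates by blast
  have "\<exists>e\<in>{E (2 * n)..E (2 * n - 1)}. \<not> strongly_stable V \<kappa> e \<and>
      (\<exists>r::real. r \<noteq> 0 \<and> transverse_eigenvalues V \<kappa> e = {complex_of_real r, complex_of_real (inverse r)})"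
    if n: "1 \<le> n" for n
  proof -
    obtain e where e: "e \<in> {E (2 * n)..E (2 * n - 1)}" "\<not> strongly_stable V \<kappa> e"
      using E(4) n by blast
    have "0 < E (2 * n)" using E(1) n by simp
    with e have "0 < e" by simp
    with e show ?thesis
      using real_eigenvalues_if_not_strongly_stable by blast
  qed
  with E is_running_solution_running_solution synchronous_solves_coupled show ?thesis
    by (intro conjI exI[of _ E]) blast+
qed

end
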